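(* Let $G=(V,E)$ be a simple (no self-loops, no parallel edges), undirected, connected graph with $n=|V|$ vertices and $m=|E|$ edges, given by adjacency lists, and let $k\in[2,n]$ be an integer. Let $s$ be the number of $k$-subtrees of $G$. There is an algorithm that lists every $k$-subtree of $G$ exactly once in $O(nk^2+sk^3)=O(sk^3)$ time using $O(mk)$ space.
   Context: A $k$-subtree of $G$ is an edge subset $T\subseteq E$ with $|T|=k-1$ that is acyclic and connected and whose edges have exactly $k$ distinct endpoints (an acyclic connected subgraph of $G$ with $k$ vertices). Each $k$-subtree is output explicitly as its list of edges. Running times are in the standard RAM model. *)

theory Defs
  imports Main
begin

section \<open>Graphs and subtrees\<close>

text \<open>An undirected edge is a two-element set, so parallel edges cannot occur.\<close>

definition simple_graph :: "'v set \<Rightarrow> 'v set set \<Rightarrow> bool" where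
  "simple_graph V E \<longleftrightarrow> finite V \<and> (\<forall>e\<in>E. \<exists>u\<in>V. \<exists>v\<in>V. u \<noteq> v \<and> e = {u, v})"

definition connected_graph :: "'v set \<Rightarrow> 'v set set \<Rightarrow> bool" where
  "connected_graph V E \<longleftrightarrow>
     V \<noteq> {} \<and> (\<forall>u\<in>V. \<forall>v\<in>V. (u, v) \<in> {(x, y). {x, y} \<in> E}\<^sup>*)"

definition is_cycle :: "'v set set \<Rightarrow> 'v list \<Rightarrow> bool" where
  "is_cycle T vs \<longleftrightarrow> 3 \<le> length vs \<and> distinct vs \<and>
     (\<forall>i<length vs. {vs ! i, vs ! (Suc i mod length vs)} \<in> T)"

definition acyclic_edges :: "'v set set \<Rightarrow> bool" where
  "acyclic_edges T \<longleftrightarrow> (\<nexists>vs. is_cycle T vs)"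

definition k_subtrees :: "'v set set \<Rightarrow> nat \<Rightarrow> 'v set set set" where
  "k_subtrees E k =
     {T. T \<subseteq> E \<and> card T = k - 1 \<and> acyclic_edges T \<and>
         connected_graph (\<Union>T) T \<and> card (\<Union>T) = k}"

section \<open>Random access machine\<close>

text \<open>
  A RAM with a bank of registers, a random access memory and a write-only output stream.
  A program can name registers only by constants, so it uses a fixed finite number of them.
  Words are natural numbers; \<open>Sub\<close> is truncated subtraction.
  Every instruction takes unit time, which is realistic only for words of logarithmic length;
  \<open>ram_run\<close> below therefore carries a bound on all words that occur. The machine
  halts as soon as the program counter leaves the program.
\<close>

datatype instr =
    LoadConst nat nat
  | Move nat nat
  | Add nat nat nat
  | Sub nat nat nat
  | Load nat nat
  | Store nat nat
  | Jump nat
  | JumpEq nat nat nat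
  | JumpLess nat nat nat
  | Output nat

record config =
  pc :: nat
  reg :: "nat \<Rightarrow> nat"
  mem :: "nat \<Rightarrow> nat"
  out :: "nat list"

definition set_reg :: "nat \<Rightarrow> nat \<Rightarrow> config \<Rightarrow> config" where
  "set_reg r x c = c\<lparr>reg := (reg c)(r := x), pc := Suc (pc c)\<rparr>"

fun exec :: "instr \<Rightarrow> config \<Rightarrow> config" where
  "exec (LoadConst r x) c = set_reg r x c"
| "exec (Move r p) c = set_reg r (reg c p) c"
| "exec (Add r p q) c = set_reg r (reg c p + reg c q) c"
| "exec (Sub r p q) c = set_reg r (reg c p - reg c q) c"
| "exec (Load r p) c = set_reg r (mem c (reg c p)) c"
| "exec (Store p q) c = c\<lparr>mem := (mem c)(reg c p := reg c q), pc := Suc (pc c)\<rparr>"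
| "exec (Jump l) c = c\<lparr>pc := l\<rparr>"
| "exec (JumpEq p q l) c = c\<lparr>pc := if reg c p = reg c q then l else Suc (pc c)\<rparr>"
| "exec (JumpLess p q l) c = c\<lparr>pc := if reg c p < reg c q then l else Suc (pc c)\<rparr>"
| "exec (Output p) c = c\<lparr>out := out c @ [reg c p], pc := Suc (pc c)\<rparr>"

fun accessed :: "instr \<Rightarrow> config \<Rightarrow> nat set" where
  "accessed (Load r p) c = {reg c p}"
| "accessed (Store p q) c = {reg c p}"
| "accessed _ c = {}"

definition halted :: "instr list \<Rightarrow> config \<Rightarrow> bool" where
  "halted P c \<longleftrightarrow> length P \<le> pc c"

definition step :: "instr list \<Rightarrow> config \<Rightarrow> config" where
  "step P c = (if halted P c then c else exec (P ! pc c) c)"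

definition init_config :: "nat list \<Rightarrow> config" where
  "init_config inp =
     \<lparr>pc = 0, reg = (\<lambda>_. 0), mem = (\<lambda>a. if a < length inp then inp ! a else 0), out = []\<rparr>"

text \<open>
  \<open>ram_run P inp B t S ys\<close>: on input \<open>inp\<close> (stored in memory from address 0),
  program \<open>P\<close> halts after exactly \<open>t\<close> instructions with output \<open>ys\<close>; it uses only the
  memory cells \<open>0, \<dots>, S - 1\<close>, the input cells included; and every word ever held in a
  register or memory cell is below \<open>B\<close>. Space is thus measured by the highest address, so
  sparse use of the zero-initialised memory is not free. The constantly many registers of
  \<open>P\<close> and the write-only output are not counted.
\<close>

definition ram_run ::
  "instr list \<Rightarrow> nat list \<Rightarrow> nat \<Rightarrow> nat \<Rightarrow> nat \<Rightarrow> nat list \<Rightarrow> bool" where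
  "ram_run P inp B t S ys \<longleftrightarrow>
     (let c = (\<lambda>i. (step P ^^ i) (init_config inp)) in
        halted P (c t) \<and> (\<forall>i<t. \<not> halted P (c i)) \<and> out (c t) = ys \<and>
        length inp \<le> S \<and> (\<forall>i<t. accessed (P ! pc (c i)) (c i) \<subseteq> {..<S}) \<and>
        (\<forall>i\<le>t. \<forall>a. reg (c i) a < B \<and> mem (c i) a < B))"

section \<open>Input and output formats\<close>

text \<open>
  As usual for adjacency lists, the vertices are numbered \<open>0, \<dots>, n - 1\<close>.
  The order within each adjacency list is arbitrary.
\<close>

definition adjacency_lists :: "nat set \<Rightarrow> nat set set \<Rightarrow> nat list list \<Rightarrow> bool" where
  "adjacency_lists V E adj \<longleftrightarrow> V = {..<length adj} \<and>
     (\<forall>u<length adj. distinct (adj ! u) \<and> set (adj ! u) = {v. {u, v} \<in> E})"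

text \<open>
  Memory layout of the input: \<open>n\<close>, \<open>k\<close>, then \<open>n + 1\<close> addresses, then all adjacency lists one
  after the other. The list of vertex \<open>u\<close> occupies the cells from the address stored in cell
  \<open>2 + u\<close> up to, but excluding, the address stored in cell \<open>3 + u\<close>.
\<close>

definition input_words :: "nat list list \<Rightarrow> nat \<Rightarrow> nat list" where
  "input_words adj k =
     [length adj, k] @
     map (\<lambda>u. length adj + 3 + length (concat (take u adj))) [0..<length adj + 1] @
     concat adj"

text \<open>
  A tree is output as the list of its \<open>k - 1\<close> edges, each edge as its two endpoints, so every
  tree is a block of \<open>2 * (k - 1)\<close> words and the output stream can be decoded uniquely.
\<close>

definition edge_set :: "(nat \<times> nat) list \<Rightarrow> nat set set" where
  "edge_set es = (\<lambda>(u, v). {u, v}) ` set es"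

definition lists_k_subtrees_once :: "nat set set \<Rightarrow> nat \<Rightarrow> nat list \<Rightarrow> bool" where
  "lists_k_subtrees_once E k ys \<longleftrightarrow>
     (\<exists>ts. ys = concat (map (\<lambda>es. concat (map (\<lambda>(u, v). [u, v]) es)) ts) \<and>
           (\<forall>es\<in>set ts. length es = k - 1) \<and>
           distinct (map edge_set ts) \<and> edge_set ` set ts = k_subtrees E k)"

end

theory Submission
  imports Defs
begin

text \<open>
  Every subtree is generated at its largest vertex \<open>r\<close>, in the graph induced by \<open>{0..r}\<close>, whose adjacency
  lists are obtained from those of the previous root by adding \<open>r\<close>. From \<open>r\<close>, a subtree is determined by
  its breadth-first sequence: the adjacency lists of the tree vertices, in order of insertion, are
  scanned once, and each entry that is not yet a tree vertex is either taken or rejected for good.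
  Backtracking over these decisions lists each subtree once.

  Exponential dead ends are avoided as follows. Completing a partial tree greedily takes \<open>O(k\<^sup>2)\<close> time,
  since only tree vertices are skipped. If it succeeds, it yields the next subtree; if it gets stuck,
  then the partial tree has no completion at all, and the decisions made by the greedy run need not be
  revisited. So there are at most \<open>k\<close> failures between two outputs, which gives \<open>O(k\<^sup>3)\<close> time per subtree,
  plus \<open>O(k\<^sup>2)\<close> per root. As the graph is connected, every edge lies in a \<open>k\<close>-subtree, hence
  \<open>m \<le> s * (k - 1)\<close> and the time for reading the graph is absorbed.
\<close>

subsection \<open>Trees and connected graphs\<close>

text \<open>Rejecting an entry forbids one edge, not its endpoint, which may still be reached from
  another tree vertex. Hence a dead end shows no local sign, and the greedy run is the test: when it
  stops short of \<open>k\<close>, the collected set is closed under all entries still open, so no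
  sequence of choices leads out of it. A run costs O(k^2) only if each entry passed is a tree vertex
  or becomes one. Entries above the root would have to be passed as well, with no bound in
  \<open>k\<close>; this is why the lists grow along with the root instead of being filtered. A
  failed run lowers the fall-back level by one, and an output resets it to \<open>k\<close>. The
  measure (trees left) * (k + 1) + level therefore drops with every run, which bounds the failures.
  The machine is compared with the list \<open>enum ... @ alts ...\<close> of trees still due, not
  with a search tree. As all words must stay below a power of \<open>n\<close>, execution is split
  into blocks of at most 32 instructions, between which the words are bounded.\<close>

lemma rtrancl_crossing:
  assumes "(x, y) \<in> R\<^sup>*" "x \<in> U" "y \<notin> U"
  shows "\<exists>u w. (u, w) \<in> R \<and> u \<in> U \<and> w \<notin> U"
  using assms by (induction rule: rtrancl_induct) blast+

lemma connected_crossing: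
  assumes "connected_graph V T" "x \<in> U" "x \<in> V" "y \<in> V" "y \<notin> U"
  obtains u w where "{u, w} \<in> T" "u \<in> U" "w \<notin> U"
proof -
  have "(x, y) \<in> {(x, y). {x, y} \<in> T}\<^sup>*"
    using assms unfolding connected_graph_def by blast
  from rtrancl_crossing[OF this assms(2,5)] show ?thesis using that by blast
qed

text \<open>From \<open>U\<close>, the vertices of \<open>V - U\<close> can be attached in turn by
  crossing edges of \<open>T\<close>. Each such edge is new because \<open>F\<close> stays inside
  the current \<open>U\<close>, so \<open>T\<close> has at least \<open>card (V - U)\<close> edges
  outside \<open>F\<close>.\<close>

lemma connected_card_edges:
  assumes conn: "connected_graph V T" and fin: "finite T" "finite V"
    and "\<Union>T \<subseteq> V" "U \<subseteq> V" "U \<noteq> {}" "F \<subseteq> T" "\<Union>F \<subseteq> U"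
  shows "card V + card F \<le> card T + card U"
  using assms(4-)
proof (induction "card (V - U)" arbitrary: U F)
  case 0
  hence "V = U" using fin by auto
  moreover have "card F \<le> card T" using 0 fin by (simp add: card_mono)
  ultimately show ?case by simp
next
  case (Suc d)
  then obtain y where y: "y \<in> V" "y \<notin> U" by (metis Diff_iff card.empty ex_in_conv nat.distinct(1))
  obtain x where x: "x \<in> U" "x \<in> V" using Suc.prems by blast
  obtain u w where uw: "{u, w} \<in> T" "u \<in> U" "w \<notin> U"
    using connected_crossing[OF conn x y] .
  have w: "w \<in> V" using uw Suc.prems(1) by blast
  have fU: "finite U" and fF: "finite F"
    using Suc.prems fin finite_subset by blast+
  have eF: "{u, w} \<notin> F" using uw Suc.prems by blast
  have "card (V - insert w U) = d"
    using Suc.hyps(2) w uw fin by (simp add: Diff_insert2 [symmetric] card_Diff_insert)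
  hence "card V + card (insert {u, w} F) \<le> card T + card (insert w U)"
    using Suc.prems uw w by (intro Suc.hyps(1)) auto
  thus ?case using fU fF eF uw by simp
qed

text \<open>Growth by leaves mirrors the search. The vertex set is an argument of its own because a
  lone root has no edge and would be lost in the union of \<open>T\<close>.\<close>

inductive tree_on :: "'v set set \<Rightarrow> 'v set \<Rightarrow> bool" where
  single: "tree_on {} {r}"
| grow: "tree_on T U \<Longrightarrow> u \<in> U \<Longrightarrow> w \<notin> U \<Longrightarrow> tree_on (insert {u, w} T) (insert w U)"

lemma tree_on_finite: "tree_on T U \<Longrightarrow> finite T \<and> finite U"
  by (induction rule: tree_on.induct) auto

lemma tree_on_Union: "tree_on T U \<Longrightarrow> \<Union>T \<subseteq> U"
  by (induction rule: tree_on.induct) auto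

lemma tree_on_nonempty: "tree_on T U \<Longrightarrow> U \<noteq> {}"
  by (induction rule: tree_on.induct) auto

lemma tree_on_card: "tree_on T U \<Longrightarrow> card U = Suc (card T)"
proof (induction rule: tree_on.induct)
  case (grow T U u w)
  have "{u, w} \<notin> T" using tree_on_Union[OF grow(1)] grow by blast
  thus ?case using grow tree_on_finite[OF grow(1)] by simp
qed simp

lemma tree_on_Union_eq: "tree_on T U \<Longrightarrow> T \<noteq> {} \<Longrightarrow> \<Union>T = U"
proof (induction rule: tree_on.induct)
  case (grow T U u w)
  show ?case
  proof (cases "T = {}")
    case True
    hence "card U = 1" using tree_on_card[OF grow(1)] by simp
    hence "U = {u}" using grow by (auto simp: card_1_singleton_iff)
    thus ?thesis using True by auto
  qed (use grow in auto)
qed simp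

lemma tree_on_connected: "tree_on T U \<Longrightarrow> connected_graph U T"
proof (induction rule: tree_on.induct)
  case (grow T U u w)
  let ?R = "\<lambda>T. {(x, y). {x, y} \<in> T}"
  have mono: "(?R T)\<^sup>* \<subseteq> (?R (insert {u, w} T))\<^sup>*" by (intro rtrancl_mono) auto
  have e: "(u, w) \<in> ?R (insert {u, w} T)" "(w, u) \<in> ?R (insert {u, w} T)"
    by (auto simp: insert_commute)
  have old: "(x, y) \<in> (?R (insert {u, w} T))\<^sup>*" if "x \<in> U" "y \<in> U" for x y
    using grow.IH that mono unfolding connected_graph_def by blast
  have "(x, y) \<in> (?R (insert {u, w} T))\<^sup>*" if "x \<in> insert w U" "y \<in> insert w U" for x y
  proof -
    have "(x, u) \<in> (?R (insert {u, w} T))\<^sup>*"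
      using that e old grow.hyps by (cases "x = w") auto
    moreover have "(u, y) \<in> (?R (insert {u, w} T))\<^sup>*"
      using that e old grow.hyps by (cases "y = w") auto
    ultimately show ?thesis by (rule rtrancl_trans)
  qed
  thus ?case unfolding connected_graph_def by blast
qed (simp add: connected_graph_def)

lemma cycle_two_neighbours:
  assumes "is_cycle T vs" "w \<in> set vs"
  obtains x y where "x \<noteq> y" "{x, w} \<in> T" "{w, y} \<in> T"
proof -
  let ?l = "length vs"
  have l: "3 \<le> ?l" "distinct vs"
    and e: "\<And>i. i < ?l \<Longrightarrow> {vs ! i, vs ! (Suc i mod ?l)} \<in> T"
    using assms(1) unfolding is_cycle_def by auto
  obtain i where i: "i < ?l" "w = vs ! i" using assms(2) by (auto simp: in_set_conv_nth)
  define h where "h = (if i = 0 then ?l - 1 else i - 1)"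
  define j where "j = Suc i mod ?l"
  have h: "h < ?l" "Suc h mod ?l = i" using l i by (auto simp: h_def)
  have "0 < ?l" using l by linarith
  hence j: "j < ?l" unfolding j_def by (rule mod_less_divisor)
  \<comment> \<open>Predecessor and successor could coincide only if \<open>length vs\<close> were
    at most 2.\<close>
  have "h \<noteq> j"
  proof (cases "Suc i = ?l")
    case True thus ?thesis using l i by (auto simp: h_def j_def)
  next
    case False thus ?thesis using l i by (auto simp: h_def j_def)
  qed
  hence "vs ! h \<noteq> vs ! j" using h j l nth_eq_iff_index_eq by blast
  moreover have "{vs ! h, w} \<in> T" using e[OF h(1)] h i by simp
  moreover have "{w, vs ! j} \<in> T" using e[OF i(1)] i by (simp add: j_def)
  ultimately show ?thesis using that by blast
qed

lemma cycle_mono: "is_cycle T vs \<Longrightarrow> (\<And>i. i < length vs \<Longrightarrow> {vs ! i, vs ! (Suc i mod length vs)} \<in> T') \<Longrightarrow> is_cycle T' vs"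
  unfolding is_cycle_def by auto

text \<open>The new leaf \<open>w\<close> has \<open>u\<close> as its only neighbour, so by
  \<open>cycle_two_neighbours\<close> no cycle passes through it, and any cycle would already lie in
  \<open>T\<close>.\<close>

lemma tree_on_acyclic: "tree_on T U \<Longrightarrow> acyclic_edges T"
proof (induction rule: tree_on.induct)
  case (single r)
  show ?case by (fastforce simp: acyclic_edges_def is_cycle_def)
next
  case (grow T U u w)
  have wT: "w \<notin> \<Union>T" using tree_on_Union[OF grow(1)] grow by blast
  show ?case unfolding acyclic_edges_def
  proof
    assume "\<exists>vs. is_cycle (insert {u, w} T) vs"
    then obtain vs where vs: "is_cycle (insert {u, w} T) vs" by blast
    have "w \<notin> set vs"
    proof
      assume "w \<in> set vs"
      from cycle_two_neighbours[OF vs this] obtain x y where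
        "x \<noteq> y" "{x, w} \<in> insert {u, w} T" "{w, y} \<in> insert {u, w} T" .
      thus False using wT grow.hyps by (auto simp: doubleton_eq_iff)
    qed
    have "is_cycle T vs"
    proof (rule cycle_mono[OF vs])
      fix i assume i: "i < length vs"
      have "0 < length vs" using i by linarith
      hence "Suc i mod length vs < length vs" by (rule mod_less_divisor)
      hence "vs ! i \<noteq> w" "vs ! (Suc i mod length vs) \<noteq> w"
        using \<open>w \<notin> set vs\<close> i nth_mem by metis+
      moreover have "{vs ! i, vs ! (Suc i mod length vs)} \<in> insert {u, w} T"
        using vs i unfolding is_cycle_def by blast
      ultimately show "{vs ! i, vs ! (Suc i mod length vs)} \<in> T"
        by (auto simp: doubleton_eq_iff)
    qed
    thus False using grow.IH unfolding acyclic_edges_def by blast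
  qed
qed

lemma tree_on_k_subtree:
  assumes "tree_on T U" "T \<subseteq> E" "card U = k" "2 \<le> k"
  shows "T \<in> k_subtrees E k"
proof -
  have c: "card T = k - 1" using tree_on_card[OF assms(1)] assms by simp
  hence "T \<noteq> {}" using assms by auto
  hence "\<Union>T = U" using tree_on_Union_eq assms by blast
  thus ?thesis using assms c tree_on_acyclic tree_on_connected by (auto simp: k_subtrees_def)
qed

text \<open>Acyclicity in counting form: \<open>T\<close> has exactly one edge fewer than vertices,
  and the vertices outside \<open>U\<close> use up one edge each. This later excludes edges that
  close a cycle inside a partial tree.\<close>

lemma k_subtree_edge_le:
  assumes T: "T \<in> k_subtrees E k" and "2 \<le> k" "U \<subseteq> \<Union>T" "U \<noteq> {}" "F \<subseteq> T" "\<Union>F \<subseteq> U"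
  shows "card F < card U"
proof -
  have t: "card T = k - 1" "connected_graph (\<Union>T) T" "card (\<Union>T) = k"
    using T by (auto simp: k_subtrees_def)
  \<comment> \<open>Infinite sets have cardinality 0, so positive cardinalities give
    finiteness.\<close>
  have "0 < card T" "0 < card (\<Union>T)" using t assms by linarith+
  hence "finite T" "finite (\<Union>T)" by (auto intro: card_ge_0_finite)
  from connected_card_edges[OF t(2) this] assms have "k + card F \<le> card T + card U"
    using t by auto
  thus ?thesis using t assms by simp
qed

text \<open>As long as the tree misses a vertex of \<open>V\<close>, connectedness supplies an edge
  that attaches another leaf.\<close>

lemma tree_on_extend:
  assumes conn: "connected_graph V E" and "\<Union>E \<subseteq> V" "finite V"
    and "tree_on T U" "T \<subseteq> E" "U \<subseteq> V" "card U \<le> k" "k \<le> card V"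
  shows "\<exists>T' U'. tree_on T' U' \<and> T \<subseteq> T' \<and> U \<subseteq> U' \<and> T' \<subseteq> E \<and> card U' = k"
  using assms(4-)
proof (induction "k - card U" arbitrary: T U)
  case 0
  thus ?case by auto
next
  case (Suc d)
  have "finite U" using Suc.prems assms finite_subset by blast
  have "U \<noteq> V" using Suc by auto
  then obtain y where y: "y \<in> V" "y \<notin> U" using Suc.prems by blast
  obtain x where x: "x \<in> U" "x \<in> V" using Suc.prems tree_on_nonempty by blast
  obtain u w where uw: "{u, w} \<in> E" "u \<in> U" "w \<notin> U"
    using connected_crossing[OF conn x y] .
  have w: "w \<in> V" using uw assms(2) by blast
  have "\<exists>T' U'. tree_on T' U' \<and> insert {u, w} T \<subseteq> T' \<and> insert w U \<subseteq> U' \<and> T' \<subseteq> E \<and> card U' = k"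
    by (rule Suc.hyps(1)) (use Suc.prems Suc.hyps(2) uw w \<open>finite U\<close> in \<open>auto intro: tree_on.grow\<close>)
  thus ?case by blast
qed

section \<open>Bounds on the numbers of edges and vertices\<close>

lemma edge_in_k_subtree:
  assumes "simple_graph V E" "connected_graph V E" "2 \<le> k" "k \<le> card V" "e \<in> E"
  obtains T where "T \<in> k_subtrees E k" "e \<in> T"
proof -
  obtain u v where uv: "e = {u, v}" "u \<noteq> v" "u \<in> V" "v \<in> V"
    using assms unfolding simple_graph_def by blast
  have tr: "tree_on (insert {u, v} {}) (insert v {u})"
    using uv by (intro tree_on.intros) auto
  have V: "\<Union>E \<subseteq> V" "finite V" using assms unfolding simple_graph_def by auto
  have "insert {u, v} {} \<subseteq> E" using assms(5) unfolding uv(1) by blast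
  moreover have "insert v {u} \<subseteq> V" using uv by blast
  moreover have "card (insert v {u}) \<le> k" using uv(2) assms(3) by (simp add: card_insert_if)
  ultimately have "\<exists>T U. tree_on T U \<and> insert {u, v} {} \<subseteq> T \<and> insert v {u} \<subseteq> U \<and> T \<subseteq> E \<and> card U = k"
    by (rule tree_on_extend[OF assms(2) V tr _ _ _ assms(4)])
  then obtain T U where "tree_on T U" "{u, v} \<in> T" "T \<subseteq> E" "card U = k" by blast
  thus ?thesis using that[of T] tree_on_k_subtree assms(3) uv by blast
qed

lemma simple_graph_finite: "simple_graph V E \<Longrightarrow> finite E \<and> finite V \<and> \<Union>E \<subseteq> V"
proof -
  assume s: "simple_graph V E"
  hence "E \<subseteq> Pow V" "finite V" unfolding simple_graph_def by auto
  thus ?thesis using finite_subset by blast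
qed

lemma finite_k_subtrees: "finite E \<Longrightarrow> finite (k_subtrees E k)"
  by (rule finite_subset[of _ "Pow E"]) (auto simp: k_subtrees_def)

lemma card_edges_le:
  assumes "simple_graph V E" "connected_graph V E" "2 \<le> k" "k \<le> card V"
  shows "card E \<le> card (k_subtrees E k) * (k - 1)"
proof -
  have "finite (k_subtrees E k)" using assms(1) simple_graph_finite finite_k_subtrees by blast
  moreover have "E = \<Union>(k_subtrees E k)"
    using edge_in_k_subtree[OF assms] by (auto simp: k_subtrees_def)
  ultimately have "card E \<le> (\<Sum>T\<in>k_subtrees E k. card T)"
    by (metis card_Union_le_sum_card)
  also have "\<dots> = card (k_subtrees E k) * (k - 1)" by (simp add: k_subtrees_def)
  finally show ?thesis .
qed

lemma card_vertices_le:
  assumes "simple_graph V E" "connected_graph V E"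
  shows "card V \<le> Suc (card E)"
proof -
  obtain x where "x \<in> V" using assms unfolding connected_graph_def by blast
  thus ?thesis
    using connected_card_edges[OF assms(2), of "{x}" "{}"] simple_graph_finite[OF assms(1)] by simp
qed

subsection \<open>Backtracking enumeration of the subtrees with a given root\<close>

text \<open>
  A partial tree is the list \<open>vs\<close> of its vertices in order of insertion; \<open>ps ! i = (p, a)\<close> records
  that \<open>vs ! Suc i\<close> was found at position \<open>a\<close> in the list of \<open>vs ! p\<close>.
\<close>

definition tree_edges :: "'v list \<Rightarrow> (nat \<times> nat) list \<Rightarrow> ('v \<times> 'v) list" where
  "tree_edges vs ps = map (\<lambda>i. (vs ! fst (ps ! i), vs ! Suc i)) [0..<length ps]"

function enum :: "('v \<Rightarrow> 'v list) \<Rightarrow> nat \<Rightarrow> 'v list \<Rightarrow> (nat \<times> nat) list \<Rightarrow> nat \<Rightarrow> nat \<Rightarrow>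
    ('v \<times> 'v) list list" where
  "enum L k vs ps p a =
     (if k \<le> length vs then [tree_edges vs ps]
      else if length vs \<le> p then []
      else if length (L (vs ! p)) \<le> a then enum L k vs ps (Suc p) 0
      else if L (vs ! p) ! a \<in> set vs then enum L k vs ps p (Suc a)
      else enum L k (vs @ [L (vs ! p) ! a]) (ps @ [(p, a)]) p (Suc a) @ enum L k vs ps p (Suc a))"
  by pat_completeness auto
termination
  by (relation "measures [\<lambda>(L, k, vs, ps, p, a). k - length vs,
        \<lambda>(L, k, vs, ps, p, a). length vs - p, \<lambda>(L, k, vs, ps, p, a). length (L (vs ! p)) - a]") auto

text \<open>This is \<open>enum\<close> without the rejecting branch. The result is a stack, not a
  list of edges, because the search resumes from its frames.\<close>

function greedy :: "('v \<Rightarrow> 'v list) \<Rightarrow> nat \<Rightarrow> 'v list \<Rightarrow> (nat \<times> nat) list \<Rightarrow> nat \<Rightarrow> nat \<Rightarrow>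
    'v list \<times> (nat \<times> nat) list" where
  "greedy L k vs ps p a =
     (if k \<le> length vs then (vs, ps)
      else if length vs \<le> p then (vs, ps)
      else if length (L (vs ! p)) \<le> a then greedy L k vs ps (Suc p) 0
      else if L (vs ! p) ! a \<in> set vs then greedy L k vs ps p (Suc a)
      else greedy L k (vs @ [L (vs ! p) ! a]) (ps @ [(p, a)]) p (Suc a))"
  by pat_completeness auto
termination
  by (relation "measures [\<lambda>(L, k, vs, ps, p, a). k - length vs,
        \<lambda>(L, k, vs, ps, p, a). length vs - p, \<lambda>(L, k, vs, ps, p, a). length (L (vs ! p)) - a]") auto

declare enum.simps [simp del] greedy.simps [simp del]

text \<open>The work pending on the stack: for each of the lowest \<open>i\<close> frames, from the
  top down, what remains once its entry is rejected. It acts as a continuation of the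
  search.\<close>

fun alts :: "('v \<Rightarrow> 'v list) \<Rightarrow> nat \<Rightarrow> 'v list \<Rightarrow> (nat \<times> nat) list \<Rightarrow> nat \<Rightarrow> ('v \<times> 'v) list list" where
  "alts L k vs ps 0 = []"
| "alts L k vs ps (Suc i) =
     enum L k (take (Suc i) vs) (take i ps) (fst (ps ! i)) (Suc (snd (ps ! i))) @ alts L k vs ps i"

text \<open>The lowest \<open>i\<close> frames alone determine their pending work, so frames above
  them may be pushed or dropped freely.\<close>

lemma alts_append:
  "i \<le> length ps \<Longrightarrow> i \<le> length vs \<Longrightarrow> alts L k (vs @ vs') (ps @ ps') i = alts L k vs ps i"
  by (induction i) (auto simp: nth_append)

lemma greedy_append:
  "\<exists>ws qs. greedy L k vs ps p a = (vs @ ws, ps @ qs) \<and> length ws = length qs"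
proof (induction L k vs ps p a rule: greedy.induct)
  case (1 L k vs ps p a)
  note defs = greedy.simps[of L k vs ps p a]
  consider "k \<le> length vs \<or> length vs \<le> p"
    | "\<not> k \<le> length vs" "\<not> length vs \<le> p" "length (L (vs ! p)) \<le> a"
    | "\<not> k \<le> length vs" "\<not> length vs \<le> p" "\<not> length (L (vs ! p)) \<le> a" "L (vs ! p) ! a \<in> set vs"
    | "\<not> k \<le> length vs" "\<not> length vs \<le> p" "\<not> length (L (vs ! p)) \<le> a" "L (vs ! p) ! a \<notin> set vs"
    by linarith
  thus ?case
  proof cases
    case 4
    from 1(3)[OF this] obtain ws qs where
      "greedy L k (vs @ [L (vs ! p) ! a]) (ps @ [(p, a)]) p (Suc a)
         = ((vs @ [L (vs ! p) ! a]) @ ws, (ps @ [(p, a)]) @ qs)" "length ws = length qs" by blast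
    thus ?thesis using 4 by (intro exI[of _ "L (vs ! p) ! a # ws"] exI[of _ "(p, a) # qs"]) (simp add: defs)
  qed (use 1(1,2) in \<open>auto simp: defs\<close>)
qed

text \<open>
  If the greedy completion gets stuck, its vertex set contains every candidate that is still
  available, so no other sequence of choices can reach \<open>k\<close> vertices either. \<open>closed_under\<close> is the
  invariant behind this.
\<close>

definition candidates :: "('v \<Rightarrow> 'v list) \<Rightarrow> 'v list \<Rightarrow> nat \<Rightarrow> nat \<Rightarrow> 'v set" where
  "candidates L vs p a =
     {x. p < length vs \<and> x \<in> set (drop a (L (vs ! p)))} \<union> (\<Union>i\<in>{p<..<length vs}. set (L (vs ! i)))"

definition closed_under :: "('v \<Rightarrow> 'v list) \<Rightarrow> 'v list \<Rightarrow> nat \<Rightarrow> nat \<Rightarrow> 'v set \<Rightarrow> bool" where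
  "closed_under L vs p a W \<longleftrightarrow>
     candidates L vs p a \<subseteq> W \<and> (\<forall>x\<in>W - set vs. set (L x) \<subseteq> W)"

section \<open>Failure of the greedy completion is final\<close>

lemma candidates_next:
  "p < length vs \<Longrightarrow> length (L (vs ! p)) \<le> a \<Longrightarrow> candidates L vs (Suc p) 0 = candidates L vs p a"
  unfolding candidates_def
proof (intro set_eqI)
  fix x assume "p < length vs" "length (L (vs ! p)) \<le> a"
  hence "{p<..<length vs} = {x. Suc p < length vs \<and> x = Suc p} \<union> {Suc p<..<length vs}" by auto
  thus "x \<in> {x. Suc p < length vs \<and> x \<in> set (drop 0 (L (vs ! Suc p)))} \<union> (\<Union>i\<in>{Suc p<..<length vs}. set (L (vs ! i)))
    \<longleftrightarrow> x \<in> {x. p < length vs \<and> x \<in> set (drop a (L (vs ! p)))} \<union> (\<Union>i\<in>{p<..<length vs}. set (L (vs ! i)))"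
    using \<open>length (L (vs ! p)) \<le> a\<close> by auto
qed

lemma candidates_drop:
  assumes "p < length vs" "a < length (L (vs ! p))"
  shows "candidates L vs p a = insert (L (vs ! p) ! a) (candidates L vs p (Suc a))"
  using assms unfolding candidates_def by (auto simp: Cons_nth_drop_Suc [symmetric])

lemma candidates_snoc:
  assumes "p < length vs"
  shows "candidates L (vs @ [w]) p a = candidates L vs p a \<union> set (L w)"
proof -
  have "{p<..<Suc (length vs)} = insert (length vs) {p<..<length vs}" using assms by auto
  moreover have "(vs @ [w]) ! p = vs ! p" using assms by (simp add: nth_append)
  moreover have "(\<Union>i\<in>{p<..<length vs}. set (L ((vs @ [w]) ! i))) = (\<Union>i\<in>{p<..<length vs}. set (L (vs ! i)))"
    by (auto simp: nth_append)
  ultimately show ?thesis using assms unfolding candidates_def by (auto simp: nth_append)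
qed

text \<open>A stuck run has scanned the old lists from \<open>(p, a)\<close> on and the lists of all
  vertices that it added. Every entry it met was in the tree or joined it.\<close>

lemma greedy_closed:
  assumes "greedy L k vs ps p a = (vs', ps')" "length vs' < k"
  shows "closed_under L vs p a (set vs')"
  using assms
proof (induction L k vs ps p a rule: greedy.induct)
  case (1 L k vs ps p a)
  note defs = greedy.simps[of L k vs ps p a]
  obtain ws where ws: "vs' = vs @ ws" using greedy_append[of L k vs ps p a] 1(4) by auto
  hence nk: "\<not> k \<le> length vs" using 1(5) by auto
  consider "length vs \<le> p" | "\<not> length vs \<le> p" "length (L (vs ! p)) \<le> a"
    | "\<not> length vs \<le> p" "\<not> length (L (vs ! p)) \<le> a" "L (vs ! p) ! a \<in> set vs"
    | "\<not> length vs \<le> p" "\<not> length (L (vs ! p)) \<le> a" "L (vs ! p) ! a \<notin> set vs"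
    by linarith
  thus ?case
  proof cases
    case 1
    hence "vs' = vs" using nk "1.prems" by (simp add: defs)
    thus ?thesis using 1 by (auto simp: closed_under_def candidates_def)
  next
    case 2
    hence "closed_under L vs (Suc p) 0 (set vs')" using nk "1.prems" "1.IH"(1) by (simp add: defs)
    thus ?thesis using 2 candidates_next[of p vs L a] by (simp add: closed_under_def)
  next
    case 3
    hence "closed_under L vs p (Suc a) (set vs')" using nk "1.prems" "1.IH"(2) by (simp add: defs)
    thus ?thesis using 3 ws candidates_drop[of p vs a L] by (auto simp: closed_under_def)
  next
    case 4
    let ?w = "L (vs ! p) ! a"
    have g: "greedy L k (vs @ [?w]) (ps @ [(p, a)]) p (Suc a) = (vs', ps')"
      using 4 nk "1.prems" by (simp add: defs)
    hence "closed_under L (vs @ [?w]) p (Suc a) (set vs')" using nk 4 "1.prems" "1.IH"(3) by simp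
    moreover have "?w \<in> set vs'" using greedy_append[of L k "vs @ [?w]" "ps @ [(p, a)]" p "Suc a"] g by auto
    ultimately show ?thesis using 4 candidates_drop[of p vs a L] candidates_snoc[of p vs L ?w "Suc a"]
      by (auto simp: closed_under_def)
  qed
qed

text \<open>A vertex that can be taken is a candidate, hence in \<open>W\<close>, and taking it
  makes only its own list available, which lies in \<open>W\<close> too. So all branches stay within
  fewer than \<open>k\<close> vertices.\<close>

lemma enum_closed_empty:
  assumes "closed_under L vs p a W" "set vs \<subseteq> W" "distinct vs" "finite W" "card W < k"
  shows "enum L k vs ps p a = []"
  using assms
proof (induction L k vs ps p a rule: enum.induct)
  case (1 L k vs ps p a)
  note defs = enum.simps[of L k vs ps p a]
  have "length vs \<le> card W" using 1(6-8) by (metis card_mono distinct_card)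
  hence nk: "\<not> k \<le> length vs" using 1 by linarith
  consider "length vs \<le> p" | "\<not> length vs \<le> p" "length (L (vs ! p)) \<le> a"
    | "\<not> length vs \<le> p" "\<not> length (L (vs ! p)) \<le> a" "L (vs ! p) ! a \<in> set vs"
    | "\<not> length vs \<le> p" "\<not> length (L (vs ! p)) \<le> a" "L (vs ! p) ! a \<notin> set vs"
    by linarith
  thus ?case
  proof cases
    case 1
    thus ?thesis using nk by (simp add: defs)
  next
    case 2
    hence "closed_under L vs (Suc p) 0 W" using "1.prems" candidates_next[of p vs L a] by (simp add: closed_under_def)
    thus ?thesis using 2 nk "1.prems" "1.IH"(1) by (simp add: defs)
  next
    case 3
    hence "closed_under L vs p (Suc a) W" using "1.prems" candidates_drop[of p vs a L] by (simp add: closed_under_def)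
    thus ?thesis using 3 nk "1.prems" "1.IH"(2) by (simp add: defs)
  next
    case 4
    let ?w = "L (vs ! p) ! a"
    have ex: "closed_under L vs p (Suc a) W" using 4 "1.prems" candidates_drop[of p vs a L] by (simp add: closed_under_def)
    have wW: "?w \<in> W" using 4 "1.prems" candidates_drop[of p vs a L] by (simp add: closed_under_def)
    have inc: "closed_under L (vs @ [?w]) p (Suc a) W" using 4 ex wW candidates_snoc[of p vs L ?w "Suc a"]
      by (auto simp: closed_under_def)
    show ?thesis using 4 nk ex inc wW "1.prems" "1.IH"(3,4) by (simp add: defs)
  qed
qed

lemma greedy_fail:
  assumes "greedy L k vs ps p a = (vs', ps')" "length vs' < k" "distinct vs"
  shows "enum L k vs ps p a = []"
proof (rule enum_closed_empty[OF greedy_closed[OF assms(1,2)] _ assms(3)])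
  show "set vs \<subseteq> set vs'" using greedy_append[of L k vs ps p a] assms(1) by auto
  show "card (set vs') < k" using card_length[of vs'] assms(2) by linarith
qed simp

text \<open>Along the greedy path \<open>enum\<close> always enters its first branch, and each
  pushed frame stores the branch passed over. So the greedy tree is the first one due, and the
  frames hold all the others. The pending work of the initial frames is carried along because the
  induction pushes frames.\<close>

lemma greedy_success:
  assumes "greedy L k vs ps p a = (vs', ps')" "k \<le> length vs'" "length vs = Suc (length ps)"
  shows "enum L k vs ps p a @ alts L k vs ps (length ps) = tree_edges vs' ps' # alts L k vs' ps' (length ps')"
  using assms
proof (induction L k vs ps p a rule: greedy.induct)
  case (1 L k vs ps p a)
  note defs = enum.simps[of L k vs ps p a] greedy.simps[of L k vs ps p a]
  consider "k \<le> length vs" | "\<not> k \<le> length vs" "length vs \<le> p" | "\<not> k \<le> length vs" "\<not> length vs \<le> p" "length (L (vs ! p)) \<le> a"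
    | "\<not> k \<le> length vs" "\<not> length vs \<le> p" "\<not> length (L (vs ! p)) \<le> a" "L (vs ! p) ! a \<in> set vs"
    | "\<not> k \<le> length vs" "\<not> length vs \<le> p" "\<not> length (L (vs ! p)) \<le> a" "L (vs ! p) ! a \<notin> set vs"
    by linarith
  thus ?case
  proof cases
    case 1
    hence "vs' = vs" "ps' = ps" using "1.prems"(1) by (simp_all add: defs(2))
    thus ?thesis using 1 by (simp add: defs(1))
  next
    case 5
    let ?vs = "vs @ [L (vs ! p) ! a]" and ?ps = "ps @ [(p, a)]"
    have "alts L k ?vs ?ps (length ?ps) = enum L k vs ps p (Suc a) @ alts L k vs ps (length ps)"
      using "1.prems"(3) by (simp add: alts_append)
    thus ?thesis using 5 "1.IH"(3)[OF 5] "1.prems" by (simp add: defs)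
  qed (use "1.IH"(1,2) "1.prems" in \<open>auto simp: defs\<close>)
qed

text \<open>
  The edges before position \<open>(p, a)\<close> have been decided for good: \<open>completions\<close> may contain them
  only if they are already in \<open>T\<close>.
\<close>

definition processed :: "('v \<Rightarrow> 'v list) \<Rightarrow> 'v list \<Rightarrow> nat \<Rightarrow> nat \<Rightarrow> 'v set set" where
  "processed L vs p a =
     {{vs ! i, x} |i x. i < length vs \<and> (i < p \<and> x \<in> set (L (vs ! i)) \<or> i = p \<and> x \<in> set (take a (L (vs ! i))))}"

definition completions :: "('v \<Rightarrow> 'v list) \<Rightarrow> 'v set set \<Rightarrow> nat \<Rightarrow> 'v set set \<Rightarrow> 'v list \<Rightarrow> nat \<Rightarrow> nat \<Rightarrow> 'v set set set" where
  "completions L E k T vs p a =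
     {T' \<in> k_subtrees E k. T \<subseteq> T' \<and> set vs \<subseteq> \<Union>T' \<and> T' \<inter> processed L vs p a \<subseteq> T}"

section \<open>Correctness of the enumeration from one root\<close>

lemma processed_next:
  assumes "p < length vs" "length (L (vs ! p)) \<le> a"
  shows "processed L vs (Suc p) 0 = processed L vs p a"
proof -
  have "i < Suc p \<and> x \<in> set (L (vs ! i)) \<or> i = Suc p \<and> x \<in> set (take 0 (L (vs ! i))) \<longleftrightarrow>
      i < p \<and> x \<in> set (L (vs ! i)) \<or> i = p \<and> x \<in> set (take a (L (vs ! i)))" for i x
    using assms by (auto simp: less_Suc_eq)
  thus ?thesis unfolding processed_def by simp
qed

lemma processed_Suc:
  assumes "p < length vs" "a < length (L (vs ! p))"
  shows "processed L vs p (Suc a) = insert {vs ! p, L (vs ! p) ! a} (processed L vs p a)"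
proof -
  have "x \<in> set (take (Suc a) (L (vs ! p))) \<longleftrightarrow> x = L (vs ! p) ! a \<or> x \<in> set (take a (L (vs ! p)))" for x
    using assms by (auto simp: take_Suc_conv_app_nth)
  thus ?thesis using assms unfolding processed_def by auto
qed

lemma processed_snoc:
  assumes "p < length vs"
  shows "processed L (vs @ [w]) p a = processed L vs p a"
  using assms unfolding processed_def by (auto simp: nth_append less_Suc_eq)

lemma tree_edges_snoc:
  assumes "length vs = Suc (length ps)" "\<forall>i<length ps. fst (ps ! i) < length vs" "p < length vs"
  shows "tree_edges (vs @ [w]) (ps @ [(p, a)]) = tree_edges vs ps @ [(vs ! p, w)]"
  using assms by (auto simp: tree_edges_def nth_append)

lemma edge_set_snoc: "edge_set (es @ [(u, w)]) = insert {u, w} (edge_set es)"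
  by (simp add: edge_set_def)

text \<open>An entry outside the tree splits the completions into those with its edge and those
  without. An entry inside the tree changes nothing. When the scan ends, all edges leaving
  \<open>vs\<close> have been rejected, so connectedness leaves no completion with more
  vertices.\<close>

lemma enum_correct:
  fixes L :: "nat \<Rightarrow> nat list"
  assumes L: "\<And>u. distinct (L u)" "\<And>u x. x \<in> set (L u) \<longleftrightarrow> {u, x} \<in> E" and "2 \<le> k"
    and "tree_on (edge_set (tree_edges vs ps)) (set vs)" "edge_set (tree_edges vs ps) \<subseteq> E"
    "distinct vs" "length vs = Suc (length ps)" "\<forall>i<length ps. fst (ps ! i) < length vs" "length vs \<le> k"
  shows "edge_set ` set (enum L k vs ps p a) = completions L E k (edge_set (tree_edges vs ps)) vs p a \<and>
     distinct (map edge_set (enum L k vs ps p a)) \<and> (\<forall>es\<in>set (enum L k vs ps p a). length es = k - 1)"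
  using assms
proof (induction L k vs ps p a rule: enum.induct)
  case (1 L k vs ps p a)
  note defs = enum.simps[of L k vs ps p a]
  note pr = "1.prems"
  let ?T = "edge_set (tree_edges vs ps)"
  have card_vs: "card (set vs) = length vs" using pr(6) by (rule distinct_card)
  have vs_ne: "set vs \<noteq> {}" using pr(7) by auto
  consider "k \<le> length vs" | "\<not> k \<le> length vs" "length vs \<le> p" | "\<not> k \<le> length vs" "\<not> length vs \<le> p" "length (L (vs ! p)) \<le> a"
    | "\<not> k \<le> length vs" "\<not> length vs \<le> p" "\<not> length (L (vs ! p)) \<le> a" "L (vs ! p) ! a \<in> set vs"
    | "\<not> k \<le> length vs" "\<not> length vs \<le> p" "\<not> length (L (vs ! p)) \<le> a" "L (vs ! p) ! a \<notin> set vs"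
    by linarith
  thus ?case
  proof cases
    case 1
    hence k: "k = length vs" using pr by simp
    have T: "?T \<in> k_subtrees E k" using tree_on_k_subtree[OF pr(4,5)] card_vs k pr(3) by simp
    have cT: "card ?T = k - 1" using T by (simp add: k_subtrees_def)
    \<comment> \<open>All k-subtrees have \<open>k - 1\<close> edges, so inclusion forces
      equality.\<close>
    have "T' = ?T" if "T' \<in> k_subtrees E k" "?T \<subseteq> T'" for T'
    proof -
      have c: "card T' = k - 1" using that by (simp add: k_subtrees_def)
      hence "finite T'" using pr(3) by (intro card_ge_0_finite) simp
      thus ?thesis using card_subset_eq[of T' ?T] that c cT by simp
    qed
    moreover have "set vs = \<Union>?T"
      using tree_on_Union_eq[OF pr(4)] cT pr(3) by fastforce
    ultimately have "completions L E k ?T vs p a = {?T}"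
      using T unfolding completions_def by auto
    moreover have "length (tree_edges vs ps) = k - 1" using k pr(7) by (simp add: tree_edges_def)
    ultimately show ?thesis using 1 by (simp add: defs)
  next
    case 2
    have "completions L E k ?T vs p a = {}"
    proof (rule ccontr)
      assume "completions L E k ?T vs p a \<noteq> {}"
      then obtain T' where T': "T' \<in> k_subtrees E k" "?T \<subseteq> T'" "set vs \<subseteq> \<Union>T'"
        "T' \<inter> processed L vs p a \<subseteq> ?T" unfolding completions_def by blast
      have "card (\<Union>T') = k" and conn: "connected_graph (\<Union>T') T'" using T' by (auto simp: k_subtrees_def)
      hence "\<Union>T' \<noteq> set vs" using card_vs 2 by auto
      then obtain y where y: "y \<in> \<Union>T'" "y \<notin> set vs" using T' by blast
      obtain x where x: "x \<in> set vs" "x \<in> \<Union>T'" using vs_ne T'(3) by (metis ex_in_conv subsetD)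
      \<comment> \<open>\<open>T'\<close> must leave \<open>vs\<close> by some edge. With the scan
        over, that edge is processed, so it would have to be a tree edge.\<close>
      obtain u w where uw: "{u, w} \<in> T'" "u \<in> set vs" "w \<notin> set vs"
        using connected_crossing[OF conn x y] .
      have "{u, w} \<in> E" using uw T' by (auto simp: k_subtrees_def)
      hence "w \<in> set (L u)" using pr(2) by blast
      moreover obtain i where "i < length vs" "u = vs ! i" using uw by (auto simp: in_set_conv_nth)
      ultimately have "{u, w} \<in> processed L vs p a" using 2 unfolding processed_def by fastforce
      hence "{u, w} \<in> ?T" using T' uw by blast
      thus False using tree_on_Union[OF pr(4)] uw by blast
    qed
    thus ?thesis using 2 by (simp add: defs)
  next
    case 3
    have "completions L E k ?T vs (Suc p) 0 = completions L E k ?T vs p a"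
      using 3 processed_next[of p vs L a] by (simp add: completions_def)
    thus ?thesis using 3 "1.IH"(1)[OF 3 pr] by (simp add: defs)
  next
    case 4
    let ?w = "L (vs ! p) ! a"
    let ?e = "{vs ! p, ?w}"
    have p: "p < length vs" "a < length (L (vs ! p))" using 4 by auto
    \<comment> \<open>a cycle-closing edge within \<open>vs\<close> leaves too few edges to connect the other vertices\<close>
    have "?e \<in> ?T" if T': "T' \<in> k_subtrees E k" "?T \<subseteq> T'" "set vs \<subseteq> \<Union>T'" "?e \<in> T'" for T'
    proof (rule ccontr)
      assume e: "?e \<notin> ?T"
      have "card (insert ?e ?T) < card (set vs)"
        by (rule k_subtree_edge_le[OF T'(1) pr(3) T'(3) vs_ne])
          (use T' tree_on_Union[OF pr(4)] 4 p in auto)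
      thus False using e tree_on_card[OF pr(4)] tree_on_finite[OF pr(4)] by simp
    qed
    hence "completions L E k ?T vs p (Suc a) = completions L E k ?T vs p a"
      using processed_Suc[of p vs a L, OF p] unfolding completions_def by auto
    thus ?thesis using 4 "1.IH"(2)[OF 4 pr] by (simp add: defs)
  next
    case 5
    let ?w = "L (vs ! p) ! a"
    let ?e = "{vs ! p, ?w}"
    let ?vs = "vs @ [?w]" and ?ps = "ps @ [(p, a)]"
    have p: "p < length vs" "a < length (L (vs ! p))" using 5 by auto
    have te: "tree_edges ?vs ?ps = tree_edges vs ps @ [(vs ! p, ?w)]"
      using tree_edges_snoc[OF pr(7,8) p(1)] .
    have es: "edge_set (tree_edges ?vs ?ps) = insert ?e ?T" unfolding te by (rule edge_set_snoc)
    have eE: "?e \<in> E" using pr(2) p nth_mem by blast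
    have eT: "?e \<notin> ?T" using tree_on_Union[OF pr(4)] 5 by blast
    \<comment> \<open>A processed copy of \<open>?e\<close> must start at \<open>vs ! p\<close>,
      since \<open>?w\<close> is not in the tree. It would be an earlier occurrence of
      \<open>?w\<close> in a list without repetitions.\<close>
    have "?e \<notin> processed L vs p a"
    proof
      assume "?e \<in> processed L vs p a"
      then obtain i x where ix: "i < length vs" "?e = {vs ! i, x}"
        "i < p \<and> x \<in> set (L (vs ! i)) \<or> i = p \<and> x \<in> set (take a (L (vs ! i)))"
        unfolding processed_def by blast
      have "vs ! i \<noteq> ?w" using ix 5 nth_mem by metis
      hence "vs ! i = vs ! p" "x = ?w" using ix(2) by (auto simp: doubleton_eq_iff)
      hence "i = p" using pr(6) ix p nth_eq_iff_index_eq by blast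
      hence "?w \<in> set (take a (L (vs ! p)))" using ix \<open>x = ?w\<close> by auto
      moreover have "?w \<notin> set (take a (L (vs ! p)))"
        using pr(1)[of "vs ! p"] p by (auto simp: in_set_conv_nth nth_eq_iff_index_eq)
      ultimately show False by blast
    qed
    hence inc: "completions L E k (insert ?e ?T) ?vs p (Suc a) = {T' \<in> completions L E k ?T vs p a. ?e \<in> T'}"
      using processed_Suc[of p vs a L, OF p] processed_snoc[OF p(1), of L ?w "Suc a"]
      unfolding completions_def by auto
    have exc: "completions L E k ?T vs p (Suc a) = {T' \<in> completions L E k ?T vs p a. ?e \<notin> T'}"
      using processed_Suc[of p vs a L, OF p] eT unfolding completions_def by auto
    have tr: "tree_on (insert ?e ?T) (set ?vs)"
      using tree_on.grow[OF pr(4), of "vs ! p" ?w] p 5 by simp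
    have IHi: "edge_set ` set (enum L k ?vs ?ps p (Suc a)) = completions L E k (insert ?e ?T) ?vs p (Suc a) \<and>
     distinct (map edge_set (enum L k ?vs ?ps p (Suc a))) \<and> (\<forall>es\<in>set (enum L k ?vs ?ps p (Suc a)). length es = k - 1)"
    proof (rule "1.IH"(3)[OF 5 pr(1-3), unfolded es])
      show "tree_on (insert ?e ?T) (set ?vs)" by (rule tr)
      show "insert ?e ?T \<subseteq> E" using eE pr(5) by blast
      show "distinct ?vs" using pr(6) 5(4) by simp
      show "length ?vs = Suc (length ?ps)" using pr(7) by simp
      show "\<forall>i<length ?ps. fst (?ps ! i) < length ?vs"
        using pr(8) p(1) by (simp add: nth_append less_Suc_eq)
      show "length ?vs \<le> k" using 5(1) by simp
    qed
    note IHe = "1.IH"(4)[OF 5 pr]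
    have en: "enum L k vs ps p a = enum L k ?vs ?ps p (Suc a) @ enum L k vs ps p (Suc a)"
      using 5 by (simp add: defs)
    have "edge_set ` set (enum L k vs ps p a) = completions L E k ?T vs p a"
      unfolding en set_append image_Un conjunct1[OF IHi] conjunct1[OF IHe] inc exc by auto
    moreover have "distinct (map edge_set (enum L k vs ps p a))"
      unfolding en map_append distinct_append set_map conjunct1[OF IHi] conjunct1[OF IHe] inc exc
      using IHi IHe by auto
    moreover have "\<forall>es\<in>set (enum L k vs ps p a). length es = k - 1"
      unfolding en set_append ball_Un using IHi IHe by simp
    ultimately show ?thesis by simp
  qed
qed

lemma enum_root:
  fixes L :: "nat \<Rightarrow> nat list"
  assumes "\<And>u. distinct (L u)" "\<And>u x. x \<in> set (L u) \<longleftrightarrow> {u, x} \<in> E" and "2 \<le> k"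
  shows "edge_set ` set (enum L k [r] [] 0 0) = {T \<in> k_subtrees E k. r \<in> \<Union>T}"
    and "distinct (map edge_set (enum L k [r] [] 0 0))"
    and "\<forall>es\<in>set (enum L k [r] [] 0 0). length es = k - 1"
proof -
  have "edge_set (tree_edges [r] []) = {}" by (simp add: tree_edges_def edge_set_def)
  moreover have "processed L [r] 0 0 = {}" by (simp add: processed_def)
  ultimately have "completions L E k (edge_set (tree_edges [r] [])) [r] 0 0 = {T \<in> k_subtrees E k. r \<in> \<Union>T}"
    by (simp add: completions_def)
  thus "edge_set ` set (enum L k [r] [] 0 0) = {T \<in> k_subtrees E k. r \<in> \<Union>T}"
    "distinct (map edge_set (enum L k [r] [] 0 0))" "\<forall>es\<in>set (enum L k [r] [] 0 0). length es = k - 1"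
    using enum_correct[OF assms, of "[r]" "[]" 0 0] assms(3) \<open>edge_set (tree_edges [r] []) = {}\<close>
    by (simp_all add: tree_on.single)
qed

subsection \<open>Timed reachability on the random access machine\<close>

definition good_config :: "instr list \<Rightarrow> nat \<Rightarrow> nat \<Rightarrow> config \<Rightarrow> bool" where
  "good_config P B S c \<longleftrightarrow> \<not> halted P c \<and> accessed (P ! pc c) c \<subseteq> {..<S} \<and> (\<forall>a. reg c a < B \<and> mem c a < B)"

text \<open>The conditions apply before step \<open>t\<close> only, so that runs compose and the
  last configuration may be halted.\<close>

definition reach :: "instr list \<Rightarrow> nat \<Rightarrow> nat \<Rightarrow> config \<Rightarrow> nat \<Rightarrow> (config \<Rightarrow> bool) \<Rightarrow> bool" where
  "reach P B S c T Q \<longleftrightarrow>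
     (\<exists>t\<le>T. (\<forall>i<t. good_config P B S ((step P ^^ i) c)) \<and> Q ((step P ^^ t) c))"

lemma reach_refl: "Q c \<Longrightarrow> reach P B S c T Q"
  unfolding reach_def by (rule exI[of _ 0]) simp

lemma reach_mono: "reach P B S c T Q \<Longrightarrow> T \<le> T' \<Longrightarrow> (\<And>c'. Q c' \<Longrightarrow> Q' c') \<Longrightarrow> reach P B S c T' Q'"
  unfolding reach_def by (meson order_trans)

lemma reach_trans:
  assumes "reach P B S c T Q" "\<And>c'. Q c' \<Longrightarrow> reach P B S c' T' R"
  shows "reach P B S c (T + T') R"
proof -
  obtain t where t: "t \<le> T" "\<forall>i<t. good_config P B S ((step P ^^ i) c)" "Q ((step P ^^ t) c)"
    using assms(1) unfolding reach_def by blast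
  obtain t' where t': "t' \<le> T'" "\<forall>i<t'. good_config P B S ((step P ^^ i) ((step P ^^ t) c))"
      "R ((step P ^^ t') ((step P ^^ t) c))"
    using assms(2)[OF t(3)] unfolding reach_def by blast
  have "good_config P B S ((step P ^^ i) c)" if "i < t + t'" for i
  proof (cases "i < t")
    case False
    hence "i = (i - t) + t" "i - t < t'" using that by auto
    hence "(step P ^^ i) c = (step P ^^ (i - t)) ((step P ^^ t) c)" by (metis funpow_add comp_apply)
    thus ?thesis using t'(2) \<open>i - t < t'\<close> by simp
  qed (use t in blast)
  moreover have "R ((step P ^^ (t' + t)) c)" using t'(3) by (simp add: funpow_add)
  ultimately show ?thesis unfolding reach_def using t t'
    by (intro exI[of _ "t' + t"]) (auto simp: add.commute)
qed

text \<open>Jumps are followed too: a block is a fixed number of steps whose branches are decided by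
  the hypotheses. The word bounds are supplied separately by \<open>straight_reach\<close>.\<close>

primrec straight :: "instr list \<Rightarrow> nat \<Rightarrow> nat \<Rightarrow> config \<Rightarrow> (config \<Rightarrow> bool) \<Rightarrow> bool" where
  "straight P S 0 c Q \<longleftrightarrow> Q c"
| "straight P S (Suc t) c Q \<longleftrightarrow>
     pc c < length P \<and> accessed (P ! pc c) c \<subseteq> {..<S} \<and> straight P S t (exec (P ! pc c) c) Q"

text \<open>
  One instruction at most doubles the largest word. Hence it is enough to bound the words at the
  boundaries of straight-line blocks of bounded length.
\<close>

definition words_le :: "nat \<Rightarrow> (nat \<Rightarrow> nat) \<Rightarrow> bool" where
  "words_le W f \<longleftrightarrow> (\<forall>a. f a \<le> W)"

lemma words_le_upd: "words_le W f \<Longrightarrow> x \<le> W \<Longrightarrow> words_le W (f(a := x))"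
  by (simp add: words_le_def)

definition word_bounded :: "nat \<Rightarrow> config \<Rightarrow> bool" where
  "word_bounded W c \<longleftrightarrow> words_le W (reg c) \<and> words_le W (mem c)"

definition consts_bounded :: "nat \<Rightarrow> instr list \<Rightarrow> bool" where
  "consts_bounded W P \<longleftrightarrow> (\<forall>r x. LoadConst r x \<in> set P \<longrightarrow> x \<le> W)"

lemma word_bounded_exec:
  assumes "word_bounded W c" "consts_bounded W P" "i \<in> set P"
  shows "word_bounded (2 * W) (exec i c)"
proof -
  have b: "reg c a \<le> W" "mem c a \<le> W" for a
    using assms(1) by (auto simp: word_bounded_def words_le_def)
  have b2: "reg c a \<le> 2 * W" "mem c a \<le> 2 * W" "reg c a - x \<le> 2 * W" for a x
    using b[of a] by linarith+
  have s: "reg c p + reg c q \<le> 2 * W" for p q using b(1)[of p] b(1)[of q] by linarith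
  have "x \<le> 2 * W" if "LoadConst r x \<in> set P" for r x
    using assms(2) that unfolding consts_bounded_def by fastforce
  thus ?thesis using assms(3) b2 s
    by (cases i) (auto simp: word_bounded_def words_le_def set_reg_def)
qed

lemma straight_reach:
  assumes "straight P S t c Q" "word_bounded W c" "consts_bounded W P" "2 ^ t * W < B"
  shows "reach P B S c t Q"
  using assms
proof (induction t arbitrary: c W)
  case 0
  thus ?case by (simp add: reach_refl)
next
  case (Suc t)
  let ?c = "exec (P ! pc c) c"
  have W: "W < B" using Suc.prems(4) le_less_trans[of W "2 ^ Suc t * W" B] by simp
  have good: "good_config P B S c"
    using Suc.prems(1,2) W by (auto simp: good_config_def halted_def word_bounded_def words_le_def intro: le_less_trans)
  have "step P c = ?c" using Suc.prems(1) by (simp add: step_def halted_def)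
  hence "reach P B S c 1 (\<lambda>c'. c' = ?c)"
    unfolding reach_def using good by (intro exI[of _ 1]) simp
  moreover have "reach P B S ?c t Q"
  proof (rule Suc.IH)
    show "word_bounded (2 * W) ?c" using word_bounded_exec[OF Suc.prems(2,3)] Suc.prems(1) by simp
    show "consts_bounded (2 * W) P" using Suc.prems(3) by (fastforce simp: consts_bounded_def)
    show "2 ^ t * (2 * W) < B" using Suc.prems(4) by (simp add: mult_ac)
  qed (use Suc.prems(1) in simp)
  ultimately show ?case using reach_trans[of P B S c 1 _ t Q] by simp
qed

lemma reach_ram_run:
  assumes "reach P B S (init_config inp) T (\<lambda>c. halted P c \<and> word_bounded W c \<and> R (out c))"
    and "W < B" "length inp \<le> S"
  obtains t ys where "t \<le> T" "ram_run P inp B t S ys" "R ys"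
proof -
  obtain t where t: "t \<le> T" "\<forall>i<t. good_config P B S ((step P ^^ i) (init_config inp))"
    "halted P ((step P ^^ t) (init_config inp))" "R (out ((step P ^^ t) (init_config inp)))"
    "word_bounded W ((step P ^^ t) (init_config inp))"
    using assms(1) unfolding reach_def by blast
  \<comment> \<open>\<open>reach\<close> bounds the words before the last configuration;
    \<open>W\<close> takes care of that one.\<close>
  have "\<forall>i\<le>t. \<forall>a. reg ((step P ^^ i) (init_config inp)) a < B \<and> mem ((step P ^^ i) (init_config inp)) a < B"
    using t(2,5) assms(2) unfolding good_config_def word_bounded_def words_le_def
    by (metis le_less_trans le_neq_implies_less)
  hence "ram_run P inp B t S (out ((step P ^^ t) (init_config inp)))"
    unfolding ram_run_def Let_def using t assms(3) by (simp add: good_config_def)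
  thus ?thesis using that t(1,4) by blast
qed

subsection \<open>The program\<close>

text \<open>
  Registers: 0 and 1 hold the constants 0 and 1, 2 and 3 hold \<open>n\<close> and \<open>k\<close>, and 4 to 9 hold
  \<open>D, 2 * D, \<dots>, 6 * D\<close>, where \<open>D\<close> is the length of the input. Register 10 is the current root,
  11 the number of vertices of the partial tree, 12 the level \<open>j\<close> to which a failing greedy
  completion falls back, 13 and 14 the position \<open>(p, a)\<close>; the others are scratch.

  Memory consists of seven banks of size \<open>D\<close>: the input; the lists \<open>L u\<close> of neighbours of \<open>u\<close>, at the
  offset that the list of \<open>u\<close> has in the input; their lengths; the marks of the vertices of the
  partial tree; \<open>vs\<close>; and the two components of \<open>ps\<close>, the frame of \<open>vs ! i\<close> being stored at index \<open>i\<close>.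

  Entry points: 11 next root, 17 insertion of the root into the lists, 43 start at this root,
  50 greedy completion, 79 output, 92 backtracking, 100 resumption, 107 root exhausted.
\<close>

definition prog :: "instr list" where
  "prog = [
    LoadConst 1 1, Load 2 0, Load 3 1, Add 4 2 1, Add 4 4 1, Load 4 4, Add 5 4 4,
    Add 6 5 4, Add 7 6 4, Add 8 7 4, Add 9 8 4,
    JumpEq 10 2 109, Add 15 10 1, Add 15 15 1, Load 19 15, Add 15 15 1, Load 20 15,
    JumpEq 19 20 43, Load 15 19, Add 19 19 1, JumpLess 15 10 22, Jump 17,
    Add 16 5 10, Load 17 16, Add 18 17 1, Store 16 18, Add 16 10 1, Add 16 16 1,
    Load 16 16, Add 16 16 17, Add 16 16 4, Store 16 15,
    Add 16 5 15, Load 17 16, Add 18 17 1, Store 16 18, Add 16 15 1, Add 16 16 1,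
    Load 16 16, Add 16 16 17, Add 16 16 4, Store 16 10, Jump 17,
    Store 7 10, Add 15 6 10, Store 15 1, Move 11 1, Move 12 1, Move 13 0,
    Move 14 0,
    JumpEq 11 3 79, JumpEq 13 11 92, Add 15 7 13, Load 15 15, Add 16 5 15,
    Load 16 16, JumpLess 14 16 60, Add 13 13 1, Move 14 0, Jump 50,
    Add 16 15 1, Add 16 16 1, Load 16 16, Add 16 16 4, Add 16 16 14, Load 16 16,
    Add 17 6 16, Load 18 17, JumpEq 18 1 77, Store 17 1, Add 18 7 11, Store 18 16,
    Add 18 8 11, Store 18 13, Add 18 9 11, Store 18 14, Add 11 11 1, Add 14 14 1,
    Jump 50,
    Move 12 3, Move 15 1,
    JumpEq 15 3 92, Add 16 8 15, Load 16 16, Add 16 7 16, Load 16 16, Output 16,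
    Add 16 7 15, Load 16 16, Output 16, Add 15 15 1, Jump 81,
    Sub 12 12 1,
    JumpEq 11 12 100, Sub 11 11 1, Add 15 7 11, Load 15 15, Add 15 6 15,
    Store 15 0, Jump 93,
    JumpEq 12 0 107, Add 15 8 11, Load 13 15, Add 15 9 11, Load 14 15, Add 14 14 1,
    Jump 50,
    Add 10 10 1, Jump 11]"

text \<open>
  A copy of \<open>straight prog\<close> in which unfolding \<open>prog_def\<close> does not insert the whole program.
\<close>

definition block :: "nat \<Rightarrow> nat \<Rightarrow> config \<Rightarrow> (config \<Rightarrow> bool) \<Rightarrow> bool" where
  "block = straight prog"

lemma block_0: "block S 0 c Q \<longleftrightarrow> Q c"
  by (simp add: block_def)

lemma block_Suc: "block S (Suc t) c Q \<longleftrightarrow>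
     pc c < length prog \<and> accessed (prog ! pc c) c \<subseteq> {..<S} \<and> block S t (exec (prog ! pc c) c) Q"
  by (simp add: block_def)

lemma block_numeral: "block S (numeral t) c Q \<longleftrightarrow>
     pc c < length prog \<and> accessed (prog ! pc c) c \<subseteq> {..<S} \<and> block S (pred_numeral t) (exec (prog ! pc c) c) Q"
  by (simp only: numeral_eq_Suc block_Suc)

lemma block_1: "block S 1 c Q \<longleftrightarrow>
     pc c < length prog \<and> accessed (prog ! pc c) c \<subseteq> {..<S} \<and> Q (exec (prog ! pc c) c)"
  by (simp add: block_def One_nat_def)

lemma length_prog: "length prog = 109"
  by (simp add: prog_def)

lemma consts_bounded_prog: "1 \<le> W \<Longrightarrow> consts_bounded W prog"
  by (simp add: prog_def consts_bounded_def)

declare One_nat_def [simp del]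

section \<open>Encoding of the output stream\<close>

definition encode_edges :: "(nat \<times> nat) list \<Rightarrow> nat list" where
  "encode_edges es = concat (map (\<lambda>(u, v). [u, v]) es)"

definition encode_trees :: "(nat \<times> nat) list list \<Rightarrow> nat list" where
  "encode_trees ts = concat (map encode_edges ts)"

lemma encode_trees_simps:
  "encode_trees [] = []" "encode_trees (t # ts) = encode_edges t @ encode_trees ts"
  "encode_trees (ts @ ts') = encode_trees ts @ encode_trees ts'"
  by (simp_all add: encode_trees_def)

text \<open>Indexed by frames, to match the output loop, which emits one edge per frame.\<close>

lemma encode_tree_edges:
  "encode_edges (tree_edges vs ps) = concat (map (\<lambda>i. [vs ! fst (ps ! i), vs ! (i + 1)]) [0..<length ps])"
  by (simp add: encode_edges_def tree_edges_def comp_def Suc_eq_plus1 del: add_Suc_right)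

lemma nth_concat_take: "u < length xss \<Longrightarrow> i < length (xss ! u) \<Longrightarrow>
    concat xss ! (length (concat (take u xss)) + i) = xss ! u ! i"
proof (induction xss arbitrary: u)
  case (Cons xs xss)
  thus ?case by (cases u) (auto simp: nth_append)
qed simp

subsection \<open>Correctness of the program blocks\<close>

text \<open>Seven times the input length bounds the addresses of the seven banks and, between
  blocks, every word. The factor 2^32 pays for one doubling per instruction of a block.\<close>

locale graph_input =
  fixes adj :: "nat list list" and E :: "nat set set" and k B :: nat
  assumes simple: "simple_graph {..<length adj} E"
    and adj: "adjacency_lists {..<length adj} E adj"
    and k: "2 \<le> k" "k \<le> length adj"
    and B: "2 ^ 32 * (7 * length (input_words adj k)) < B"
begin

section \<open>Memory layout and its invariants\<close>

abbreviation n :: nat where "n \<equiv> length adj"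

definition D :: nat where "D = length (input_words adj k)"

abbreviation S :: nat where "S \<equiv> 7 * D"

definition off :: "nat \<Rightarrow> nat" where "off u = n + 3 + length (concat (take u adj))"

lemma length_concat_take_mono: "u \<le> v \<Longrightarrow> length (concat (take u adj)) \<le> length (concat (take v adj))"
  by (metis append_take_drop_id concat_append length_append le_add1 min.absorb1 take_take)

lemma D_eq: "D = n + 3 + length (concat adj)"
  by (simp add: D_def input_words_def)

lemma off_Suc: "u < n \<Longrightarrow> off (Suc u) = off u + length (adj ! u)"
  by (simp add: off_def take_Suc_conv_app_nth)

lemma off_n: "off n = D"
  by (simp add: off_def D_eq)

lemma off_mono: "u \<le> v \<Longrightarrow> off u \<le> off v"
  using length_concat_take_mono by (simp add: off_def)

lemma off_le_D: "u \<le> n \<Longrightarrow> off u \<le> D"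
  using off_mono off_n by metis

lemma n_less_D: "n + 3 \<le> D"
  by (simp add: D_eq)

lemma k_bounds: "k \<le> n" "2 \<le> k" "2 \<le> n" "3 \<le> D"
  using k n_less_D by auto

lemma off_add_less: "u < n \<Longrightarrow> i < length (adj ! u) \<Longrightarrow> off u + i < D"
  using off_Suc[of u] off_le_D[of "Suc u"] by simp

text \<open>The lists occupy disjoint intervals, so appending to one leaves the others
  intact.\<close>

lemma off_inj:
  assumes "u < n" "v < n" "i < length (adj ! u)" "j < length (adj ! v)" "off u + i = off v + j"
  shows "u = v"
proof (rule ccontr)
  assume "u \<noteq> v"
  hence "Suc u \<le> v \<or> Suc v \<le> u" by linarith
  thus False
    using off_mono[of "Suc u" v] off_mono[of "Suc v" u] off_Suc assms by auto
qed

abbreviation inp :: "nat list" where "inp \<equiv> input_words adj k"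

lemma inp_0: "inp ! 0 = n" and inp_1: "inp ! 1 = k"
  by (simp_all add: input_words_def)

lemma inp_off: "u \<le> n \<Longrightarrow> inp ! (u + 2) = off u"
  by (simp add: input_words_def off_def nth_append del: upt_Suc)

lemma inp_adj: "u < n \<Longrightarrow> i < length (adj ! u) \<Longrightarrow> inp ! (off u + i) = adj ! u ! i"
  using nth_concat_take[of u adj i] by (simp add: input_words_def off_def nth_append add.assoc del: upt_Suc)

lemma adj_distinct: "u < n \<Longrightarrow> distinct (adj ! u)"
  using adj by (simp add: adjacency_lists_def)

lemma adj_iff: "u < n \<Longrightarrow> x \<in> set (adj ! u) \<longleftrightarrow> {u, x} \<in> E"
  using adj by (simp add: adjacency_lists_def)

lemma edge_bounds: "{u, x} \<in> E \<Longrightarrow> u < n \<and> x < n \<and> u \<noteq> x"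
  using simple by (fastforce simp: simple_graph_def doubleton_eq_iff)

definition input_at :: "(nat \<Rightarrow> nat) \<Rightarrow> bool" where
  "input_at M \<longleftrightarrow> (\<forall>a<D. M a = inp ! a)"

definition lists_at :: "(nat \<Rightarrow> nat list) \<Rightarrow> (nat \<Rightarrow> nat) \<Rightarrow> bool" where
  "lists_at L M \<longleftrightarrow> (\<forall>u<n. M (2 * D + u) = length (L u)) \<and>
     (\<forall>u<n. \<forall>i<length (L u). M (D + (off u + i)) = L u ! i)"

definition marks_at :: "nat set \<Rightarrow> (nat \<Rightarrow> nat) \<Rightarrow> bool" where
  "marks_at X M \<longleftrightarrow> (\<forall>u<n. M (3 * D + u) = (if u \<in> X then 1 else 0))"

definition stack_at :: "nat list \<Rightarrow> (nat \<times> nat) list \<Rightarrow> (nat \<Rightarrow> nat) \<Rightarrow> bool" where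
  "stack_at vs ps M \<longleftrightarrow> (\<forall>i<length vs. M (4 * D + i) = vs ! i) \<and>
     (\<forall>i<length ps. M (5 * D + Suc i) = fst (ps ! i) \<and> M (6 * D + Suc i) = snd (ps ! i))"

text \<open>The entries need not follow the order of \<open>adj\<close>, since grown lists keep the
  order of insertion. What matters is that they fit into the space of the input lists.\<close>

definition sublists :: "(nat \<Rightarrow> nat list) \<Rightarrow> bool" where
  "sublists L \<longleftrightarrow> (\<forall>u. distinct (L u) \<and> (\<forall>x\<in>set (L u). {u, x} \<in> E))"

lemma length_sublist:
  assumes "sublists L" "u < n"
  shows "length (L u) \<le> length (adj ! u)"
proof -
  have "set (L u) \<subseteq> set (adj ! u)" using assms adj_iff by (auto simp: sublists_def)
  hence "card (set (L u)) \<le> card (set (adj ! u))" by (simp add: card_mono)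
  thus ?thesis using assms adj_distinct by (simp add: sublists_def distinct_card)
qed

lemma sublist_address:
  assumes "sublists L" "u < n" "i < length (L u)"
  shows "off u + i < D"
  using off_add_less[of u i] length_sublist[OF assms(1,2)] assms by simp

lemma input_at_upd: "input_at M \<Longrightarrow> D \<le> x \<Longrightarrow> input_at (M(x := y))"
  by (simp add: input_at_def)

lemma lists_at_upd: "lists_at L M \<Longrightarrow> sublists L \<Longrightarrow> 3 * D \<le> x \<Longrightarrow> lists_at L (M(x := y))"
  using sublist_address[of L] n_less_D unfolding lists_at_def by fastforce

lemma marks_at_upd: "marks_at X M \<Longrightarrow> x < 3 * D \<or> 4 * D \<le> x \<Longrightarrow> marks_at X (M(x := y))"
  using n_less_D unfolding marks_at_def by fastforce

lemma stack_at_upd: "stack_at vs ps M \<Longrightarrow> x < 4 * D \<Longrightarrow> stack_at vs ps (M(x := y))"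
  unfolding stack_at_def by fastforce

lemma marks_at_insert: "marks_at X M \<Longrightarrow> marks_at (insert w X) (M(3 * D + w := 1))"
  unfolding marks_at_def by simp

lemma marks_at_remove: "marks_at (insert w X) M \<Longrightarrow> w \<notin> X \<Longrightarrow> marks_at X (M(3 * D + w := 0))"
  unfolding marks_at_def by simp

lemma stack_at_push:
  assumes "stack_at vs ps M" "length vs = Suc (length ps)" "length vs < D"
  shows "stack_at (vs @ [w]) (ps @ [(p, a)])
     (M(4 * D + length vs := w, 5 * D + length vs := p, 6 * D + length vs := a))"
  using assms unfolding stack_at_def by (auto simp: nth_append less_Suc_eq)

lemma stack_at_take: "stack_at vs ps M \<Longrightarrow> stack_at (take i vs) (take j ps) M"
  unfolding stack_at_def by simp

definition append_at :: "nat \<Rightarrow> nat \<Rightarrow> (nat \<Rightarrow> nat list) \<Rightarrow> nat \<Rightarrow> nat list" where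
  "append_at u x L = L(u := L u @ [x])"

lemma lists_at_append:
  assumes "lists_at L M" "sublists (append_at u x L)" "u < n"
  shows "lists_at (append_at u x L)
    (M(2 * D + u := length (L u) + 1, off u + length (L u) + D := x))"
proof -
  let ?L = "append_at u x L"
  have L: "sublists L" using assms(2) unfolding sublists_def append_at_def
    by (metis distinct_append fun_upd_apply set_append Un_iff)
  have au: "length (L u) < length (adj ! u)"
    using length_sublist[OF assms(2,3)] by (simp add: append_at_def)
  have aD: "off u + length (L u) < D" using off_add_less[OF assms(3) au] .
  \<comment> \<open>The cell to be written holds no stored entry: by \<open>off_inj\<close> such an
    entry would belong to \<open>u\<close> itself, at position \<open>length (L u)\<close>, which is
    past its end.\<close>
  have ne: "off v + i \<noteq> off u + length (L u)" if "v < n" "i < length (L v)" for v i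
  proof
    assume e: "off v + i = off u + length (L u)"
    have "i < length (adj ! v)" using that length_sublist[OF L] by (meson less_le_trans)
    hence "v = u" using off_inj[OF that(1) assms(3) _ au e] by blast
    thus False using e that by simp
  qed
  have lt: "off v + i < D" if "v < n" "i < length (L v)" for v i
    using sublist_address[OF L that] .
  have n: "v < D" if "v < n" for v using that n_less_D by linarith
  show ?thesis unfolding lists_at_def
  proof (intro conjI allI impI)
    fix v assume "v < n"
    thus "(M(2 * D + u := length (L u) + 1, off u + length (L u) + D := x)) (2 * D + v) = length (?L v)"
      using assms(1) aD unfolding lists_at_def by (auto simp: append_at_def)
  next
    fix v i assume v: "v < n" and i: "i < length (?L v)"
    show "(M(2 * D + u := length (L u) + 1, off u + length (L u) + D := x)) (D + (off v + i)) = ?L v ! i"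
    proof (cases "v = u \<and> i = length (L u)")
      case True
      thus ?thesis by (simp add: append_at_def)
    next
      case False
      hence i': "i < length (L v)" using i by (auto simp: append_at_def split: if_splits)
      hence "?L v ! i = L v ! i" by (auto simp: append_at_def nth_append)
      moreover have "M (D + (off v + i)) = L v ! i" using assms(1) v i' unfolding lists_at_def by blast
      moreover have "D + (off v + i) \<noteq> off u + length (L u) + D" using ne[OF v i'] by linarith
      moreover have "D + (off v + i) \<noteq> 2 * D + u" using lt[OF v i'] by linarith
      ultimately show ?thesis by simp
    qed
  qed
qed

definition base :: "config \<Rightarrow> bool" where
  "base c \<longleftrightarrow> reg c 0 = 0 \<and> reg c 1 = 1 \<and> reg c 2 = n \<and> reg c 3 = k \<and> reg c 4 = D \<and> reg c 5 = 2 * D \<and>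
     reg c 6 = 3 * D \<and> reg c 7 = 4 * D \<and> reg c 8 = 5 * D \<and> reg c 9 = 6 * D \<and>
     input_at (mem c) \<and> words_le S (reg c) \<and> words_le S (mem c)"

text \<open>The level \<open>j\<close> is independent of \<open>length vs\<close>: a greedy run
  lengthens \<open>vs\<close> while the level to fall back to stays. Stack cells beyond the current
  lengths may hold old values.\<close>

definition machine_at :: "(nat \<Rightarrow> nat list) \<Rightarrow> nat \<Rightarrow> nat list \<Rightarrow> nat \<Rightarrow> nat list \<Rightarrow> (nat \<times> nat) list \<Rightarrow> nat \<Rightarrow> nat \<Rightarrow>
    config \<Rightarrow> bool" where
  "machine_at L r ys j vs ps p a c \<longleftrightarrow> base c \<and> lists_at L (mem c) \<and> marks_at (set vs) (mem c) \<and>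
     stack_at vs ps (mem c) \<and> reg c 10 = r \<and> reg c 11 = length vs \<and> reg c 12 = j \<and> reg c 13 = p \<and>
     reg c 14 = a \<and> out c = ys"

text \<open>\<open>p = length vs\<close> is the position of a stuck scan.
  \<open>fst (ps ! i) \<le> i\<close> says that the parent of \<open>vs ! Suc i\<close> precedes
  it.\<close>

definition valid :: "nat list \<Rightarrow> (nat \<times> nat) list \<Rightarrow> nat \<Rightarrow> nat \<Rightarrow> bool" where
  "valid vs ps p a \<longleftrightarrow> distinct vs \<and> set vs \<subseteq> {..<n} \<and> length vs = Suc (length ps) \<and> length vs \<le> k \<and>
     (\<forall>i<length ps. fst (ps ! i) \<le> i \<and> snd (ps ! i) < D) \<and> p \<le> length vs \<and> a \<le> D"

lemma block_reach:
  assumes "block S t c Q" "base c" "t \<le> 32" "t \<le> T"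
  shows "reach prog B S c T Q"
proof -
  have "2 ^ t * S \<le> 2 ^ 32 * S" using assms(3) by (intro mult_right_mono power_increasing) auto
  hence "2 ^ t * S < B" using B unfolding D_def by linarith
  moreover have "consts_bounded S prog" using consts_bounded_prog k_bounds(4) by simp
  moreover have "word_bounded S c" using assms(2) by (simp add: base_def word_bounded_def)
  ultimately have "reach prog B S c t Q"
    using straight_reach assms(1) unfolding block_def by blast
  thus ?thesis using assms(4) reach_mono by blast
qed

lemmas block_simps = block_0 block_1 block_Suc block_numeral length_prog prog_def set_reg_def
lemmas upd_simps = input_at_upd lists_at_upd marks_at_upd stack_at_upd words_le_upd

lemma valid_nth: "valid vs ps p a \<Longrightarrow> i < length vs \<Longrightarrow> vs ! i < n"
  unfolding valid_def by (meson lessThan_iff nth_mem subsetD)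

lemma valid_length: "valid vs ps p a \<Longrightarrow> length vs < D"
  using n_less_D k_bounds by (simp add: valid_def)

lemma base_mem_le: "base c \<Longrightarrow> mem c x \<le> S"
  by (simp add: base_def words_le_def)

section \<open>Machine blocks of the greedy completion\<close>

lemma block_next_vertex:
  assumes "machine_at L r ys j vs ps p a c" "pc c = 50" "valid vs ps p a"
    "length vs \<noteq> k" "p < length vs" "length (L (vs ! p)) \<le> a"
  shows "block S 10 c (\<lambda>c'. pc c' = 50 \<and> machine_at L r ys j vs ps (p + 1) 0 c')"
proof -
  have v: "vs ! p < n" "length vs < D" "vs ! p < D"
    using valid_nth[OF assms(3,5)] valid_length[OF assms(3)] n_less_D by auto
  have m: "mem c (4 * D + p) = vs ! p" "mem c (2 * D + vs ! p) = length (L (vs ! p))"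
    using assms v by (auto simp: machine_at_def stack_at_def lists_at_def)
  have "length (L (vs ! p)) \<le> S"
    using base_mem_le[of c "2 * D + vs ! p"] assms(1) m(2) by (simp add: machine_at_def)
  thus ?thesis using assms(1,2,4-6) v m
    by (simp add: block_simps upd_simps machine_at_def base_def)
qed

lemma block_skip:
  assumes "machine_at L r ys j vs ps p a c" "pc c = 50" "valid vs ps p a" "sublists L"
    "length vs \<noteq> k" "p < length vs" "a < length (L (vs ! p))" "L (vs ! p) ! a \<in> set vs"
  shows "block S 18 c (\<lambda>c'. pc c' = 50 \<and> machine_at L r ys j vs ps p (a + 1) c')"
proof -
  let ?v = "vs ! p"
  let ?w = "L ?v ! a"
  have v: "?v < n" "length vs < D" "?v < D" "?v + 2 < D"
    using valid_nth[OF assms(3,6)] valid_length[OF assms(3)] n_less_D by auto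
  have w: "?w < n" using assms(4,7) edge_bounds nth_mem unfolding sublists_def by blast
  have ad: "off ?v + a < D" using sublist_address[OF assms(4) v(1) assms(7)] .
  have m: "mem c (4 * D + p) = ?v" "mem c (2 * D + ?v) = length (L ?v)"
    "mem c (?v + 1 + 1) = off ?v" "mem c (off ?v + D + a) = ?w" "mem c (3 * D + ?w) = 1"
    using assms v w inp_off[of ?v]
    by (auto simp: machine_at_def stack_at_def lists_at_def base_def input_at_def marks_at_def add.assoc add.left_commute[of D])
  have "length (L ?v) \<le> S"
    using base_mem_le[of c "2 * D + ?v"] assms(1) m(2) by (simp add: machine_at_def)
  thus ?thesis using assms(1,2,5-8) v w ad m n_less_D
    by (simp add: block_simps upd_simps machine_at_def base_def)
qed

lemma block_push:
  assumes "machine_at L r ys j vs ps p a c" "pc c = 50" "valid vs ps p a" "sublists L"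
    "length vs \<noteq> k" "p < length vs" "a < length (L (vs ! p))" "L (vs ! p) ! a \<notin> set vs"
  shows "block S 26 c (\<lambda>c'. pc c' = 50 \<and>
    machine_at L r ys j (vs @ [L (vs ! p) ! a]) (ps @ [(p, a)]) p (a + 1) c')"
proof -
  let ?v = "vs ! p"
  let ?w = "L ?v ! a"
  have v: "?v < n" "length vs < D" "?v < D" "?v + 2 < D"
    using valid_nth[OF assms(3,6)] valid_length[OF assms(3)] n_less_D by auto
  have w: "?w < n" using assms(4,7) edge_bounds nth_mem unfolding sublists_def by blast
  have ad: "off ?v + a < D" using sublist_address[OF assms(4) v(1) assms(7)] .
  have m: "mem c (4 * D + p) = ?v" "mem c (2 * D + ?v) = length (L ?v)"
    "mem c (?v + 1 + 1) = off ?v" "mem c (off ?v + D + a) = ?w" "mem c (3 * D + ?w) = 0"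
    using assms v w inp_off[of ?v]
    by (auto simp: machine_at_def stack_at_def lists_at_def base_def input_at_def marks_at_def add.assoc add.left_commute[of D])
  let ?M = "(mem c)(3 * D + ?w := 1, 4 * D + length vs := ?w, 5 * D + length vs := p, 6 * D + length vs := a)"
  have "stack_at (vs @ [?w]) (ps @ [(p, a)]) ?M"
    using assms(1,3) v w n_less_D by (intro stack_at_push stack_at_upd) (auto simp: machine_at_def valid_def)
  moreover have "marks_at (insert ?w (set vs)) ?M"
    using assms(1) v w n_less_D by (intro marks_at_upd marks_at_insert) (auto simp: machine_at_def)
  moreover have "lists_at L ?M" "input_at ?M" "words_le S ?M"
    using assms(1,4,6) v w ad n_less_D
    by (simp_all add: machine_at_def base_def upd_simps)
  moreover have "length (L ?v) \<le> S"
    using base_mem_le[of c "2 * D + ?v"] assms(1) m(2) by (simp add: machine_at_def)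
  ultimately show ?thesis using assms(1,2,5-8) v w ad m n_less_D
    by (simp add: block_simps words_le_upd machine_at_def base_def)
qed

subsection \<open>The enumeration loop\<close>

text \<open>
  Counts the remaining iterations of the greedy completion: every skipped entry is a vertex of the
  tree, so at most \<open>k\<close> entries of each list are skipped.
\<close>

definition potential :: "(nat \<Rightarrow> nat list) \<Rightarrow> nat list \<Rightarrow> nat \<Rightarrow> nat \<Rightarrow> nat" where
  "potential L vs p a = (k - length vs) + (k - p) * (k + 1) +
     (if p < length vs then card (set (drop a (L (vs ! p))) \<inter> set vs) else 0)"

lemma card_Int_vs: "card (X \<inter> set vs) \<le> length vs"
  by (meson List.finite_set Int_lower2 card_length card_mono order_trans)

text \<open>Moving on releases \<open>k + 1\<close>, while the new list has fewer than
  \<open>k + 1\<close> entries to skip.\<close>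

lemma potential_next_vertex:
  assumes "length vs < k" "p < length vs"
  shows "potential L vs (p + 1) 0 < potential L vs p a"
proof -
  have "k - p = Suc (k - (p + 1))" using assms by simp
  hence "(k - p) * (k + 1) = (k - (p + 1)) * (k + 1) + (k + 1)" by (metis add.commute mult_Suc)
  moreover have "(if p + 1 < length vs then card (set (drop 0 (L (vs ! (p + 1)))) \<inter> set vs) else 0) < k + 1"
    using card_Int_vs[of "set (drop 0 (L (vs ! (p + 1))))" vs] assms by simp
  ultimately show ?thesis unfolding potential_def by linarith
qed

lemma potential_skip:
  assumes "sublists L" "p < length vs" "a < length (L (vs ! p))" "L (vs ! p) ! a \<in> set vs"
  shows "potential L vs p (a + 1) < potential L vs p a"
proof -
  let ?l = "L (vs ! p)"
  have d: "drop a ?l = ?l ! a # drop (a + 1) ?l" using Cons_nth_drop_Suc[OF assms(3)] by (metis Suc_eq_plus1)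
  have "distinct (drop a ?l)" using assms by (simp add: sublists_def)
  hence "?l ! a \<notin> set (drop (a + 1) ?l)" unfolding d by simp
  thus ?thesis using assms unfolding potential_def d by simp
qed

text \<open>The new vertex adds no skips to the current list, because its entry there has just been
  passed and does not recur. The number of missing vertices drops.\<close>

lemma potential_push:
  assumes "sublists L" "length vs < k" "p < length vs" "a < length (L (vs ! p))"
  shows "potential L (vs @ [L (vs ! p) ! a]) p (a + 1) < potential L vs p a"
proof -
  let ?l = "L (vs ! p)"
  have d: "drop a ?l = ?l ! a # drop (a + 1) ?l" using Cons_nth_drop_Suc[OF assms(4)] by (metis Suc_eq_plus1)
  have "distinct (drop a ?l)" using assms by (simp add: sublists_def)
  hence "?l ! a \<notin> set (drop (a + 1) ?l)" unfolding d by simp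
  hence "set (drop (a + 1) ?l) \<inter> set (vs @ [?l ! a]) = set (drop (a + 1) ?l) \<inter> set vs" by auto
  moreover have "card (set (drop (a + 1) ?l) \<inter> set vs) \<le> card (set (drop a ?l) \<inter> set vs)"
    unfolding d by (intro card_mono) auto
  ultimately show ?thesis using assms unfolding potential_def by (simp add: nth_append)
qed

lemma potential_le:
  assumes "length vs \<le> k"
  shows "potential L vs p a \<le> k ^ 2 + 3 * k"
proof -
  have "(k - p) * (k + 1) \<le> k * (k + 1)" by (intro mult_right_mono) auto
  moreover have "(if p < length vs then card (set (drop a (L (vs ! p))) \<inter> set vs) else 0) \<le> k"
    using card_Int_vs[of "set (drop a (L (vs ! p)))" vs] assms by simp
  ultimately show ?thesis unfolding potential_def power2_eq_square by (simp add: algebra_simps)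
qed

lemma block_exit_full:
  assumes "machine_at L r ys j vs ps p a c" "pc c = 50" "length vs = k"
  shows "block S 1 c (\<lambda>c'. pc c' = 79 \<and> machine_at L r ys j vs ps p a c')"
  using assms by (simp add: block_simps machine_at_def base_def)

lemma block_exit_stuck:
  assumes "machine_at L r ys j vs ps p a c" "pc c = 50" "length vs \<noteq> k" "p = length vs"
  shows "block S 2 c (\<lambda>c'. pc c' = 92 \<and> machine_at L r ys j vs ps p a c')"
  using assms by (simp add: block_simps machine_at_def base_def)

lemma machine_at_base: "machine_at L r ys j vs ps p a c \<Longrightarrow> base c"
  by (simp add: machine_at_def)

text \<open>The factor 26 is the length of the longest iteration, a push; the summand 2 pays for the
  exit.\<close>

lemma greedy_reach:
  assumes "machine_at L r ys j vs ps p a c" "pc c = 50" "valid vs ps p a" "sublists L"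
  shows "reach prog B S c (26 * potential L vs p a + 2) (\<lambda>c'. \<exists>vs' ps' p' a'.
     greedy L k vs ps p a = (vs', ps') \<and> valid vs' ps' p' a' \<and>
     machine_at L r ys j vs' ps' p' a' c' \<and> pc c' = (if length vs' = k then 79 else 92))"
  using assms
proof (induction "potential L vs p a" arbitrary: vs ps p a c rule: less_induct)
  case less
  note inv = less.prems(1) and valid = less.prems(3) and L = less.prems(4)
  note defs = greedy.simps[of L k vs ps p a, unfolded Suc_eq_plus1]
  have lk: "length vs \<le> k" "p \<le> length vs" "a \<le> D" using valid by (auto simp: valid_def)
  let ?Q = "\<lambda>vs ps p a c'. \<exists>vs' ps' p' a'. greedy L k vs ps p a = (vs', ps') \<and> valid vs' ps' p' a' \<and>
     machine_at L r ys j vs' ps' p' a' c' \<and> pc c' = (if length vs' = k then 79 else 92)"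
  have step: "reach prog B S c (26 * potential L vs p a + 2) (?Q vs ps p a)"
    if blk: "block S t c (\<lambda>c'. pc c' = 50 \<and> machine_at L r ys j vs1 ps1 p1 a1 c')" and t: "t \<le> 26"
      and pot: "potential L vs1 p1 a1 < potential L vs p a" and val: "valid vs1 ps1 p1 a1"
      and gr: "greedy L k vs ps p a = greedy L k vs1 ps1 p1 a1" for t vs1 ps1 p1 a1
  proof -
    have "reach prog B S c (26 + (26 * potential L vs1 p1 a1 + 2)) (?Q vs1 ps1 p1 a1)"
    proof (rule reach_trans)
      show "reach prog B S c 26 (\<lambda>c'. pc c' = 50 \<and> machine_at L r ys j vs1 ps1 p1 a1 c')"
        using block_reach[OF blk machine_at_base[OF inv]] t by simp
    next
      fix c' assume c': "pc c' = 50 \<and> machine_at L r ys j vs1 ps1 p1 a1 c'"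
      show "reach prog B S c' (26 * potential L vs1 p1 a1 + 2) (?Q vs1 ps1 p1 a1)"
        using less.hyps[OF pot _ _ val L] c' by blast
    qed
    thus ?thesis unfolding gr using pot by (rule_tac reach_mono) auto
  qed
  consider "length vs = k" | "length vs \<noteq> k" "p = length vs" | "length vs \<noteq> k" "p < length vs" "length (L (vs ! p)) \<le> a"
    | "length vs \<noteq> k" "p < length vs" "a < length (L (vs ! p))" "L (vs ! p) ! a \<in> set vs"
    | "length vs \<noteq> k" "p < length vs" "a < length (L (vs ! p))" "L (vs ! p) ! a \<notin> set vs"
    using lk by linarith
  thus ?case
  proof cases
    case 1
    have g: "greedy L k vs ps p a = (vs, ps)" by (subst defs) (use 1 lk in simp)
    show ?thesis
    proof (rule reach_mono[OF block_reach[OF block_exit_full[OF inv less.prems(2) 1] machine_at_base[OF inv] _ order_refl]])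
      fix c' assume "pc c' = 79 \<and> machine_at L r ys j vs ps p a c'"
      thus "?Q vs ps p a c'" using g valid 1(1) by auto
    qed simp_all
  next
    case 2
    have g: "greedy L k vs ps p a = (vs, ps)" by (subst defs) (use 2 lk in simp)
    show ?thesis
    proof (rule reach_mono[OF block_reach[OF block_exit_stuck[OF inv less.prems(2) 2] machine_at_base[OF inv] _ order_refl]])
      fix c' assume "pc c' = 92 \<and> machine_at L r ys j vs ps p a c'"
      thus "?Q vs ps p a c'" using g valid 2(1) by auto
    qed simp_all
  next
    case 3
    show ?thesis
    proof (rule step[OF block_next_vertex[OF inv less.prems(2) valid 3]])
      show "potential L vs (p + 1) 0 < potential L vs p a" using potential_next_vertex 3 lk by simp
      show "valid vs ps (p + 1) 0" using valid 3 by (simp add: valid_def)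
    qed (use 3 lk in \<open>simp_all add: defs\<close>)
  next
    case 4
    have "a < D" using sublist_address[OF L valid_nth[OF valid 4(2)] 4(3)] by simp
    show ?thesis
    proof (rule step[OF block_skip[OF inv less.prems(2) valid L 4]])
      show "potential L vs p (a + 1) < potential L vs p a" using potential_skip L 4 by simp
      show "valid vs ps p (a + 1)" using valid \<open>a < D\<close> by (simp add: valid_def)
    qed (use 4 lk in \<open>simp_all add: defs\<close>)
  next
    case 5
    let ?w = "L (vs ! p) ! a"
    have "a < D" using sublist_address[OF L valid_nth[OF valid 5(2)] 5(3)] by simp
    have w: "?w < n" using L 5(3) edge_bounds nth_mem unfolding sublists_def by blast
    show ?thesis
    proof (rule step[OF block_push[OF inv less.prems(2) valid L 5]])
      show "potential L (vs @ [?w]) p (a + 1) < potential L vs p a" using potential_push L 5 lk by simp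
      show "valid (vs @ [?w]) (ps @ [(p, a)]) p (a + 1)"
        using valid \<open>a < D\<close> w 5 lk by (auto simp: valid_def nth_append less_Suc_eq)
    qed (use 5 lk in \<open>simp_all add: defs\<close>)
  qed
qed

text \<open>After an output the level becomes \<open>k\<close>, so that the topmost frame is tried
  next. Register 15 starts at 1 because the root, at index 0, has no frame.\<close>

lemma block_output_start:
  assumes "machine_at L r ys j vs ps p a c" "pc c = 79"
  shows "block S 2 c (\<lambda>c'. pc c' = 81 \<and> machine_at L r ys k vs ps p a c' \<and> reg c' 15 = 1)"
  using assms k_bounds n_less_D by (simp add: block_simps upd_simps machine_at_def base_def)

lemma stack_at_frame:
  "stack_at vs ps M \<Longrightarrow> i < length ps \<Longrightarrow>
    M (5 * D + (i + 1)) = fst (ps ! i) \<and> M (6 * D + (i + 1)) = snd (ps ! i)"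
  unfolding stack_at_def Suc_eq_plus1 by simp

lemma block_output_step:
  assumes "machine_at L r ys k vs ps p a c" "pc c = 81" "reg c 15 = i + 1" "valid vs ps p a"
    "length vs = k" "i < length ps"
  shows "block S 11 c (\<lambda>c'. pc c' = 81 \<and>
    machine_at L r (ys @ [vs ! fst (ps ! i), vs ! (i + 1)]) k vs ps p a c' \<and> reg c' 15 = (i + 1) + 1)"
proof -
  let ?q = "fst (ps ! i)"
  have q: "?q < length vs" using assms(4,6) by (auto simp: valid_def intro: le_less_trans)
  have i: "i + 1 < length vs" "i + 1 < k" "i + 1 \<noteq> k" using assms(4-6) by (auto simp: valid_def)
  have v: "vs ! ?q < n" "vs ! (i + 1) < n" using valid_nth[OF assms(4)] q i by auto
  have d: "length vs < D" using valid_length[OF assms(4)] .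
  have m: "mem c (5 * D + (i + 1)) = ?q" "mem c (4 * D + ?q) = vs ! ?q"
    "mem c (4 * D + (i + 1)) = vs ! (i + 1)"
  proof -
    have st: "stack_at vs ps (mem c)" using assms(1) by (simp add: machine_at_def)
    show "mem c (5 * D + (i + 1)) = ?q" using stack_at_frame[OF st assms(6)] by simp
    show "mem c (4 * D + ?q) = vs ! ?q" "mem c (4 * D + (i + 1)) = vs ! (i + 1)"
      using st q i unfolding stack_at_def by auto
  qed
  show ?thesis using assms(1,2,3) q i v d m n_less_D
    by (simp add: block_simps upd_simps machine_at_def base_def)
qed

lemma block_output_end:
  assumes "machine_at L r ys j vs ps p a c" "pc c = 81" "reg c 15 = k"
  shows "block S 1 c (\<lambda>c'. pc c' = 92 \<and> machine_at L r ys j vs ps p a c')"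
  using assms by (simp add: block_simps machine_at_def base_def)

lemma block_level:
  assumes "machine_at L r ys j vs ps p a c" "pc c = 92" "j < D"
  shows "block S 1 c (\<lambda>c'. pc c' = 93 \<and> machine_at L r ys (j - 1) vs ps p a c')"
  using assms by (simp add: block_simps upd_simps machine_at_def base_def)

text \<open>Only \<open>vs\<close> shrinks and one mark is cleared; the frames stay until
  \<open>block_resume\<close> cuts them to match.\<close>

lemma block_pop:
  assumes "machine_at L r ys j (vs @ [v]) ps p a c" "pc c = 93" "j \<le> length vs" "v < n" "v \<notin> set vs" "length vs < n" "sublists L"
  shows "block S 7 c (\<lambda>c'. pc c' = 93 \<and> machine_at L r ys j vs ps p a c')"
proof -
  have m: "mem c (4 * D + length vs) = v" using assms(1) by (auto simp: machine_at_def stack_at_def)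
  have st: "stack_at vs ps (mem c)" using assms(1) stack_at_take[of "vs @ [v]" ps "mem c" "length vs" "length ps"]
    by (simp add: machine_at_def)
  have mk: "marks_at (set vs) ((mem c)(3 * D + v := 0))"
    using assms(1,5) by (intro marks_at_remove) (simp_all add: machine_at_def)
  have r11: "reg c 11 = length vs + 1" using assms(1) by (simp add: machine_at_def)
  show ?thesis using assms(1-4,6,7) m st mk r11 n_less_D
    by (simp add: block_simps upd_simps machine_at_def base_def)
qed

lemma block_pop_end:
  assumes "machine_at L r ys (length vs) vs ps p a c" "pc c = 93"
  shows "block S 1 c (\<lambda>c'. pc c' = 100 \<and> machine_at L r ys (length vs) vs ps p a c')"
  using assms by (simp add: block_simps machine_at_def base_def)

lemma block_finish_root:
  assumes "machine_at L r ys 0 vs ps p a c" "pc c = 100"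
  shows "block S 1 c (\<lambda>c'. pc c' = 107 \<and> machine_at L r ys 0 vs ps p a c')"
  using assms by (simp add: block_simps machine_at_def base_def)

text \<open>The frame \<open>ps ! i\<close> belongs to the vertex popped last and lies at index
  \<open>i + 1 = length vs\<close>. Its entry is now rejected, so the scan resumes just after
  it.\<close>

lemma block_resume:
  assumes "machine_at L r ys (length vs) vs ps p a c" "pc c = 100" "length vs = i + 1" "i < length ps"
    "i + 1 < D" "snd (ps ! i) < D" "fst (ps ! i) < D"
  shows "block S 7 c (\<lambda>c'. pc c' = 50 \<and>
    machine_at L r ys (length vs) vs (take i ps) (fst (ps ! i)) (snd (ps ! i) + 1) c')"
proof -
  have m: "mem c (5 * D + length vs) = fst (ps ! i)" "mem c (6 * D + length vs) = snd (ps ! i)"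
    using stack_at_frame[of vs ps "mem c" i] assms(1,3,4) by (simp_all add: machine_at_def)
  have st: "stack_at vs (take i ps) (mem c)"
    using assms(1) stack_at_take[of vs ps "mem c" "length vs" i] by (simp add: machine_at_def)
  have "length vs \<noteq> 0" "length vs < D" using assms(3,5) by simp_all
  thus ?thesis using assms(1,2,6,7) m st n_less_D
    by (simp add: block_simps upd_simps machine_at_def base_def)
qed

section \<open>The loops for output and backtracking\<close>

lemma output_loop_reach:
  assumes "machine_at L r ys k vs ps p a c" "pc c = 81" "reg c 15 = i + 1" "valid vs ps p a" "length vs = k" "i \<le> length ps"
  shows "reach prog B S c (11 * (length ps - i) + 1) (\<lambda>c'. pc c' = 92 \<and>
    machine_at L r (ys @ concat (map (\<lambda>i. [vs ! fst (ps ! i), vs ! (i + 1)]) [i..<length ps])) k vs ps p a c')"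
  using assms
proof (induction "length ps - i" arbitrary: i ys c)
  case 0
  hence i: "i = length ps" by simp
  have "reg c 15 = k" using 0(4,5,6) i by (simp add: valid_def)
  from block_reach[OF block_output_end[OF 0(2,3) this] machine_at_base[OF 0(2)], of 1] show ?case
    using i by simp
next
  case (Suc d)
  hence i: "i < length ps" "d = length ps - (i + 1)" by simp_all
  let ?ys = "ys @ [vs ! fst (ps ! i), vs ! (i + 1)]"
  have "reach prog B S c (11 + (11 * (length ps - (i + 1)) + 1)) (\<lambda>c'. pc c' = 92 \<and>
    machine_at L r (?ys @ concat (map (\<lambda>i. [vs ! fst (ps ! i), vs ! (i + 1)]) [i + 1..<length ps])) k vs ps p a c')"
  proof (rule reach_trans)
    show "reach prog B S c 11 (\<lambda>c'. pc c' = 81 \<and> machine_at L r ?ys k vs ps p a c' \<and> reg c' 15 = (i + 1) + 1)"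
      using block_reach[OF block_output_step[OF Suc.prems(1-5) i(1)] machine_at_base[OF Suc.prems(1)]] by simp
  next
    fix c' assume c': "pc c' = 81 \<and> machine_at L r ?ys k vs ps p a c' \<and> reg c' 15 = (i + 1) + 1"
    show "reach prog B S c' (11 * (length ps - (i + 1)) + 1) (\<lambda>c'. pc c' = 92 \<and>
      machine_at L r (?ys @ concat (map (\<lambda>i. [vs ! fst (ps ! i), vs ! (i + 1)]) [i + 1..<length ps])) k vs ps p a c')"
      using c' i Suc.prems(4,5) by (intro Suc.hyps(1)[OF i(2)]) simp_all
  qed
  moreover have "[i..<length ps] = i # [i + 1..<length ps]" using upt_conv_Cons[OF i(1)] by (simp only: Suc_eq_plus1)
  moreover have "11 + (11 * (length ps - (i + 1)) + 1) = 11 * (length ps - i) + 1" using i by simp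
  ultimately show ?case by simp
qed

lemma output_reach:
  assumes "machine_at L r ys j vs ps p a c" "pc c = 79" "valid vs ps p a" "length vs = k"
  shows "reach prog B S c (11 * k + 3) (\<lambda>c'. pc c' = 92 \<and>
    machine_at L r (ys @ encode_edges (tree_edges vs ps)) k vs ps p a c')"
proof -
  have "reach prog B S c (2 + (11 * (length ps - 0) + 1)) (\<lambda>c'. pc c' = 92 \<and>
    machine_at L r (ys @ concat (map (\<lambda>i. [vs ! fst (ps ! i), vs ! (i + 1)]) [0..<length ps])) k vs ps p a c')"
  proof (rule reach_trans)
    show "reach prog B S c 2 (\<lambda>c'. pc c' = 81 \<and> machine_at L r ys k vs ps p a c' \<and> reg c' 15 = 1)"
      using block_reach[OF block_output_start[OF assms(1,2)] machine_at_base[OF assms(1)]] by simp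
  qed (rule output_loop_reach, use assms(3,4) in auto)
  moreover have "2 + (11 * (length ps - 0) + 1) \<le> 11 * k + 3" using assms(3) by (simp add: valid_def)
  ultimately show ?thesis unfolding encode_tree_edges by (rule reach_mono)
qed

lemma pop_loop_reach:
  assumes "machine_at L r ys j vs ps p a c" "pc c = 93" "j \<le> length vs" "distinct vs" "set vs \<subseteq> {..<n}"
    "length vs \<le> n" "sublists L"
  shows "reach prog B S c (7 * length vs + 1) (\<lambda>c'. pc c' = 100 \<and> machine_at L r ys j (take j vs) ps p a c')"
  using assms
proof (induction vs arbitrary: c rule: rev_induct)
  case Nil
  hence "machine_at L r ys (length []) [] ps p a c" by simp
  from block_reach[OF block_pop_end[OF this Nil(2)] machine_at_base[OF this], of 1] show ?case using Nil by simp
next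
  case (snoc v vs)
  show ?case
  proof (cases "j = length (vs @ [v])")
    case True
    hence "machine_at L r ys (length (vs @ [v])) (vs @ [v]) ps p a c" using snoc.prems by simp
    from block_reach[OF block_pop_end[OF this snoc.prems(2)] machine_at_base[OF this], of "7 * length (vs @ [v]) + 1"]
    show ?thesis using True by simp
  next
    case False
    hence j: "j \<le> length vs" using snoc.prems by simp
    have v: "v < n" "v \<notin> set vs" "length vs < n" using snoc.prems by simp_all
    have "reach prog B S c (7 + (7 * length vs + 1)) (\<lambda>c'. pc c' = 100 \<and> machine_at L r ys j (take j vs) ps p a c')"
    proof (rule reach_trans)
      show "reach prog B S c 7 (\<lambda>c'. pc c' = 93 \<and> machine_at L r ys j vs ps p a c')"
        using block_reach[OF block_pop[OF snoc.prems(1,2) j v snoc.prems(7)] machine_at_base[OF snoc.prems(1)]] by simp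
    qed (use snoc j in auto)
    thus ?thesis using j by simp
  qed
qed

lemma backtrack_reach:
  assumes "machine_at L r ys j vs ps p a c" "pc c = 92" "valid vs ps p a" "j \<le> length vs" "sublists L"
  shows "reach prog B S c (7 * k + 2) (\<lambda>c'. pc c' = 100 \<and> machine_at L r ys (j - 1) (take (j - 1) vs) ps p a c')"
proof -
  have j: "j < D" using assms(4) valid_length[OF assms(3)] by simp
  have v: "distinct vs" "set vs \<subseteq> {..<n}" "length vs \<le> k" using assms(3) by (auto simp: valid_def)
  have "reach prog B S c (1 + (7 * length vs + 1))
     (\<lambda>c'. pc c' = 100 \<and> machine_at L r ys (j - 1) (take (j - 1) vs) ps p a c')"
  proof (rule reach_trans)
    show "reach prog B S c 1 (\<lambda>c'. pc c' = 93 \<and> machine_at L r ys (j - 1) vs ps p a c')"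
      using block_reach[OF block_level[OF assms(1,2) j] machine_at_base[OF assms(1)]] by simp
  qed (rule pop_loop_reach, use v assms(4,5) k_bounds in auto)
  thus ?thesis using v by (rule_tac reach_mono) auto
qed

text \<open>\<open>rest\<close> lists the trees still due. One round is a greedy run, an output if
  it succeeds, and a fall back. Success removes a tree and may raise the level to
  \<open>k - 1\<close>, whence the weight \<open>k + 1\<close>; failure lowers the level by one.
  Either way the measure drops and pays for O(k^2) steps.\<close>

lemma enumerate_reach:
  assumes "machine_at L r ys (length vs) vs ps p a c" "pc c = 50" "valid vs ps p a" "sublists L"
  defines "rest \<equiv> \<lambda>vs ps p a. enum L k vs ps p a @ alts L k vs ps (length ps)"
  shows "reach prog B S c (100 * k\<^sup>2 * (length (rest vs ps p a) * (k + 1) + length vs))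
    (\<lambda>c'. pc c' = 107 \<and> (\<exists>ps' p' a'. machine_at L r (ys @ encode_trees (rest vs ps p a)) 0 [] ps' p' a' c'))"
  using assms(1-3)
proof (induction "length (rest vs ps p a) * (k + 1) + length vs" arbitrary: ys vs ps p a c rule: less_induct)
  case less
  note L = assms(4)
  let ?N = "length (rest vs ps p a) * (k + 1) + length vs"
  let ?Q = "\<lambda>c'. pc c' = 107 \<and> (\<exists>ps' p' a'. machine_at L r (ys @ encode_trees (rest vs ps p a)) 0 [] ps' p' a' c')"
  \<comment> \<open>\<open>P2\<close> holds when backtracking begins and \<open>P3\<close> after the
    pops. \<open>i\<close> is the number of frames with pending work; the level is
    \<open>i + 1\<close> in \<open>P2\<close> because backtracking starts by decrementing
    it.\<close>
  define P2 where "P2 = (\<lambda>c' vs' ps' p' a' ys' i. valid vs' ps' p' a' \<and> i \<le> length ps' \<and>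
    ys' @ encode_trees (alts L k vs' ps' i) = ys @ encode_trees (rest vs ps p a) \<and>
    length (alts L k vs' ps' i) * (k + 1) + i < ?N \<and> pc c' = 92 \<and> machine_at L r ys' (i + 1) vs' ps' p' a' c')"
  define P3 where "P3 = (\<lambda>c' vs' ps' p' a' ys' i. valid vs' ps' p' a' \<and> i \<le> length ps' \<and>
    ys' @ encode_trees (alts L k vs' ps' i) = ys @ encode_trees (rest vs ps p a) \<and>
    length (alts L k vs' ps' i) * (k + 1) + i < ?N \<and> pc c' = 100 \<and> machine_at L r ys' i (take i vs') ps' p' a' c')"
  have lvs: "length vs = length ps + 1" using less.prems(3) by (simp add: valid_def)
  have forward: "reach prog B S c (26 * potential L vs p a + 2 + (11 * k + 3)) (\<lambda>c'. \<exists>vs' ps' p' a' ys' i. P2 c' vs' ps' p' a' ys' i)"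
  proof (rule reach_trans[OF greedy_reach[OF less.prems L]], elim exE conjE)
    fix c' vs' ps' p' a'
    assume g: "greedy L k vs ps p a = (vs', ps')" and val: "valid vs' ps' p' a'"
      and inv: "machine_at L r ys (length vs) vs' ps' p' a' c'" and pc: "pc c' = (if length vs' = k then 79 else 92)"
    show "reach prog B S c' (11 * k + 3) (\<lambda>c'. \<exists>vs' ps' p' a' ys' i. P2 c' vs' ps' p' a' ys' i)"
    proof (cases "length vs' = k")
      case True
      have lps: "length ps' + 1 = k" using val True by (simp add: valid_def)
      have r: "rest vs ps p a = tree_edges vs' ps' # alts L k vs' ps' (length ps')"
        unfolding rest_def using greedy_success[OF g] True lvs by simp
      show ?thesis
      proof (rule reach_mono[OF output_reach[OF inv _ val True]])
        fix c'' assume c'': "pc c'' = 92 \<and> machine_at L r (ys @ encode_edges (tree_edges vs' ps')) k vs' ps' p' a' c''"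
        have "P2 c'' vs' ps' p' a' (ys @ encode_edges (tree_edges vs' ps')) (length ps')"
          unfolding P2_def r using c'' val lps by (simp add: encode_trees_simps)
        thus "\<exists>vs' ps' p' a' ys' i. P2 c'' vs' ps' p' a' ys' i" by blast
      qed (use pc True in simp_all)
    next
      case False
      hence lt: "length vs' < k" using val by (simp add: valid_def)
      have dist: "distinct vs" using less.prems(3) by (simp add: valid_def)
      obtain ws qs where wq: "vs' = vs @ ws" "ps' = ps @ qs" using greedy_append[of L k vs ps p a] g by auto
      \<comment> \<open>Frames pushed by the failed run are dropped untried: their alternatives are
        part of \<open>enum\<close>, which is empty.\<close>
      have r: "rest vs ps p a = alts L k vs' ps' (length ps)"
        unfolding rest_def greedy_fail[OF g lt dist] wq using lvs by (simp add: alts_append)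
      have "P2 c' vs' ps' p' a' ys (length ps)"
        unfolding P2_def r using val inv pc False wq lvs by simp
      thus ?thesis by (blast intro: reach_refl)
    qed
  qed
  have "reach prog B S c ((26 * potential L vs p a + 2 + (11 * k + 3)) + ((7 * k + 2) + (7 + 100 * k\<^sup>2 * (?N - 1)))) ?Q"
  proof (rule reach_trans[OF forward], elim exE)
    fix c' vs' ps' p' a' ys' i assume P2: "P2 c' vs' ps' p' a' ys' i"
    hence P2': "machine_at L r ys' (i + 1) vs' ps' p' a' c'" "pc c' = 92" "valid vs' ps' p' a'" "i + 1 \<le> length vs'"
      by (auto simp: P2_def valid_def)
    have bt: "reach prog B S c' (7 * k + 2) (\<lambda>c'. P3 c' vs' ps' p' a' ys' i)"
      by (rule reach_mono[OF backtrack_reach[OF P2' L]]) (use P2 in \<open>auto simp: P2_def P3_def\<close>)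
    show "reach prog B S c' ((7 * k + 2) + (7 + 100 * k\<^sup>2 * (?N - 1))) ?Q"
    proof (rule reach_trans[OF bt])
      fix c'' assume P3: "P3 c'' vs' ps' p' a' ys' i"
      hence inv: "machine_at L r ys' i (take i vs') ps' p' a' c''" and pc: "pc c'' = 100"
        and val: "valid vs' ps' p' a'" and il: "i \<le> length ps'"
        and ys': "ys' @ encode_trees (alts L k vs' ps' i) = ys @ encode_trees (rest vs ps p a)"
        and N: "length (alts L k vs' ps' i) * (k + 1) + i < ?N"
        by (auto simp: P3_def)
      show "reach prog B S c'' (7 + 100 * k\<^sup>2 * (?N - 1)) ?Q"
      proof (cases i)
        \<comment> \<open>Even the root has been popped, so no frame is pending and the root is
          exhausted.\<close>
        case 0
        have "machine_at L r ys' 0 [] ps' p' a' c''" using inv 0 by simp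
        from block_reach[OF block_finish_root[OF this pc] machine_at_base[OF this]]
        have "reach prog B S c'' (7 + 100 * k\<^sup>2 * (?N - 1)) (\<lambda>c'. pc c' = 107 \<and> machine_at L r ys' 0 [] ps' p' a' c')" by simp
        moreover have "ys' = ys @ encode_trees (rest vs ps p a)" using ys' 0 by (simp add: encode_trees_simps)
        ultimately show ?thesis using reach_mono[OF _ order_refl, of prog B S c'' _ _ ?Q] by blast
      next
        case (Suc h)
        let ?vs = "take i vs'" and ?ps = "take h ps'" and ?p = "fst (ps' ! h)" and ?a = "snd (ps' ! h) + 1"
        have l: "length ?vs = i" "h < length ps'" "length ?ps = h"
          using il val Suc by (auto simp: valid_def)
        have q: "?p \<le> h" "snd (ps' ! h) < D" using val l by (auto simp: valid_def)
        have h: "h + 1 < D" "?p < D" using valid_length[OF val] val l q by (auto simp: valid_def)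
        have rest: "rest ?vs ?ps ?p ?a = alts L k vs' ps' i"
        proof -
          have "alts L k ?vs ?ps h = alts L k (?vs @ drop i vs') (?ps @ drop h ps') h"
            using l Suc by (intro alts_append [symmetric]) auto
          thus ?thesis unfolding rest_def using Suc l by (simp flip: Suc_eq_plus1)
        qed
        have val': "valid ?vs ?ps ?p ?a"
          using val l q Suc set_take_subset[of i vs'] by (auto simp: valid_def)
        have small: "length (rest ?vs ?ps ?p ?a) * (k + 1) + length ?vs < ?N"
          unfolding rest l using N .
        have inv': "machine_at L r ys' (length ?vs) ?vs ps' p' a' c''" using inv l by simp
        have blk: "reach prog B S c'' 7 (\<lambda>c'. pc c' = 50 \<and> machine_at L r ys' (length ?vs) ?vs ?ps ?p ?a c')"
        proof (rule block_reach[OF block_resume[OF inv' pc _ l(2) h(1) q(2) h(2)] machine_at_base[OF inv']])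
          show "length ?vs = h + 1" using l(1) Suc by simp
        qed simp_all
        have r: "reach prog B S c'' (7 + 100 * k\<^sup>2 * (length (rest ?vs ?ps ?p ?a) * (k + 1) + length ?vs))
          (\<lambda>c'. pc c' = 107 \<and> (\<exists>ps'' p' a'. machine_at L r (ys' @ encode_trees (rest ?vs ?ps ?p ?a)) 0 [] ps'' p' a' c'))"
          by (rule reach_trans[OF blk]) (use less.hyps[OF small] val' in blast)
        have le: "7 + 100 * k\<^sup>2 * (length (rest ?vs ?ps ?p ?a) * (k + 1) + length ?vs) \<le> 7 + 100 * k\<^sup>2 * (?N - 1)"
          using small by (intro add_left_mono mult_left_mono) auto
        have "ys' @ encode_trees (rest ?vs ?ps ?p ?a) = ys @ encode_trees (rest vs ps p a)"
          unfolding rest by (rule ys')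
        thus ?thesis using r by (intro reach_mono[OF r le]) auto
      qed
    qed
  qed
  \<comment> \<open>Apart from the recursive call, a round costs at most 26 k^2 + 96 k + 14, which
    is below 100 k^2 for \<open>k \<ge> 2\<close>.\<close>
  moreover have "(26 * potential L vs p a + 2 + (11 * k + 3)) + ((7 * k + 2) + (7 + 100 * k\<^sup>2 * (?N - 1))) \<le> 100 * k\<^sup>2 * ?N"
  proof -
    have "potential L vs p a \<le> k\<^sup>2 + 3 * k" using potential_le less.prems(3) by (simp add: valid_def)
    moreover have "2 * k \<le> k\<^sup>2" unfolding power2_eq_square using k_bounds by (intro mult_right_mono) auto
    moreover have "4 \<le> k\<^sup>2" using power_mono[of 2 k 2] k_bounds by simp
    moreover have "100 * k\<^sup>2 * ?N = 100 * k\<^sup>2 + 100 * k\<^sup>2 * (?N - 1)"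
    proof -
      have "?N = Suc (?N - 1)" using lvs by simp
      thus ?thesis by (metis mult_Suc_right)
    qed
    ultimately show ?thesis by linarith
  qed
  ultimately show ?case by (rule reach_mono)
qed

section \<open>Machine blocks for growing the lists and changing the root\<close>

lemma block_halt:
  assumes "machine_at L n ys j vs ps p a c" "pc c = 11"
  shows "block S 1 c (\<lambda>c'. pc c' = 109 \<and> machine_at L n ys j vs ps p a c')"
  using assms by (simp add: block_simps machine_at_def base_def)

lemma mem_off:
  assumes "base c" "u \<le> n"
  shows "mem c (u + 1 + 1) = off u"
proof -
  have "u + 1 + 1 = u + 2" by (rule add.assoc [THEN trans]) (simp only: one_add_one)
  moreover have "u + 2 < D" using assms(2) n_less_D by linarith
  ultimately show ?thesis using inp_off[OF assms(2)] assms(1) unfolding base_def input_at_def by metis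
qed

lemma block_grow_start:
  assumes "machine_at L r ys j vs ps p a c" "pc c = 11" "r < n"
  shows "block S 6 c (\<lambda>c'. pc c' = 17 \<and> machine_at L r ys j vs ps p a c' \<and>
    reg c' 19 = off r \<and> reg c' 20 = off (r + 1))"
proof -
  have "mem c (r + 1 + 1) = off r" "mem c (r + 1 + 1 + 1) = off (r + 1)"
    using mem_off[OF machine_at_base[OF assms(1)], of r] mem_off[OF machine_at_base[OF assms(1)], of "r + 1"] assms(3)
    by simp_all
  moreover have "off r \<le> D" "off (r + 1) \<le> D" using off_le_D assms(3) by simp_all
  moreover have "r < D" using assms(3) n_less_D by simp
  ultimately show ?thesis using assms n_less_D
    by (simp add: block_simps upd_simps machine_at_def base_def)
qed

lemma block_grow_end:
  assumes "machine_at L r ys j vs ps p a c" "pc c = 17" "reg c 19 = reg c 20"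
  shows "block S 1 c (\<lambda>c'. pc c' = 43 \<and> machine_at L r ys j vs ps p a c')"
  using assms by (simp add: block_simps machine_at_def base_def)

lemma mem_adj: "base c \<Longrightarrow> u < n \<Longrightarrow> q < length (adj ! u) \<Longrightarrow> mem c (off u + q) = adj ! u ! q"
  using inp_adj off_add_less by (simp add: base_def input_at_def)

lemma adj_nth_less: "u < n \<Longrightarrow> q < length (adj ! u) \<Longrightarrow> adj ! u ! q < n \<and> adj ! u ! q \<noteq> u"
  using adj_iff edge_bounds nth_mem by metis

lemma block_grow_skip:
  assumes "machine_at L r ys j vs ps p a c" "pc c = 17" "r < n" "q < length (adj ! r)"
    "reg c 19 = off r + q" "reg c 20 = off (r + 1)" "\<not> adj ! r ! q < r"
  shows "block S 5 c (\<lambda>c'. pc c' = 17 \<and> machine_at L r ys j vs ps p a c' \<and>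
    reg c' 19 = off r + q + 1 \<and> reg c' 20 = off (r + 1))"
proof -
  have m: "mem c (off r + q) = adj ! r ! q" using mem_adj[OF machine_at_base[OF assms(1)] assms(3,4)] .
  have w: "adj ! r ! q < n" using adj_nth_less[OF assms(3,4)] by simp
  have o: "off r + q < D" "off r + q \<noteq> off (r + 1)"
    using off_add_less[OF assms(3,4)] off_Suc[OF assms(3), unfolded Suc_eq_plus1] assms(4) by simp_all
  show ?thesis using assms(1,2,3,5-) m w o n_less_D
    by (simp add: block_simps upd_simps machine_at_def base_def)
qed

lemma block_grow_append_root:
  assumes "machine_at L r ys j vs ps p a c" "pc c = 17" "r < n" "q < length (adj ! r)"
    "reg c 19 = off r + q" "reg c 20 = off (r + 1)" "adj ! r ! q < r"
    "sublists (append_at r (adj ! r ! q) L)"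
  shows "block S 14 c (\<lambda>c'. pc c' = 32 \<and> machine_at (append_at r (adj ! r ! q) L) r ys j vs ps p a c' \<and>
    reg c' 15 = adj ! r ! q \<and> reg c' 19 = off r + q + 1 \<and> reg c' 20 = off (r + 1))"
proof -
  let ?w = "adj ! r ! q" and ?l = "length (L r)"
  have m: "mem c (off r + q) = ?w" "mem c (2 * D + r) = ?l" "mem c (r + 1 + 1) = off r"
    using mem_adj[OF machine_at_base[OF assms(1)] assms(3,4)] mem_off[OF machine_at_base[OF assms(1)], of r] assms(1,3)
    by (simp_all add: machine_at_def lists_at_def)
  have w: "?w < n" using adj_nth_less[OF assms(3,4)] by simp
  have o: "off r + q < D" "off r + q \<noteq> off (r + 1)"
    using off_add_less[OF assms(3,4)] off_Suc[OF assms(3), unfolded Suc_eq_plus1] assms(4) by simp_all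
  \<comment> \<open>The extended list still fits into the space of \<open>r\<close>, so the cell of
    its last entry lies in the bank.\<close>
  have l: "off r + ?l < D"
    using sublist_address[OF assms(8,3), of ?l] by (simp add: append_at_def)
  have rD: "r + 1 + 1 < D" using assms(3) n_less_D by simp
  let ?M = "(mem c)(2 * D + r := ?l + 1, off r + ?l + D := ?w)"
  have "lists_at (append_at r ?w L) ?M"
    using assms(1) by (intro lists_at_append[OF _ assms(8,3)]) (simp add: machine_at_def)
  moreover have "input_at ?M" "marks_at (set vs) ?M" "stack_at vs ps ?M" "words_le S ?M"
    using assms(1) l w rD n_less_D by (simp_all add: machine_at_def base_def upd_simps)
  ultimately show ?thesis using assms(1-3,5-7) m w o l rD n_less_D
    by (simp add: block_simps words_le_upd machine_at_def base_def)
qed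

lemma block_grow_append_neighbour:
  assumes "machine_at L r ys j vs ps p a c" "pc c = 32" "w < r" "r < n" "reg c 15 = w"
    "reg c 19 = i" "reg c 20 = i'" "sublists (append_at w r L)"
  shows "block S 11 c (\<lambda>c'. pc c' = 17 \<and> machine_at (append_at w r L) r ys j vs ps p a c' \<and>
    reg c' 19 = i \<and> reg c' 20 = i')"
proof -
  let ?l = "length (L w)"
  have m: "mem c (2 * D + w) = ?l" "mem c (w + 1 + 1) = off w"
    using mem_off[OF machine_at_base[OF assms(1)], of w] assms(1,3,4)
    by (simp_all add: machine_at_def lists_at_def)
  have w: "w < n" using assms(3,4) by simp
  have l: "off w + ?l < D"
    using sublist_address[OF assms(8) w, of ?l] by (simp add: append_at_def)
  have rD: "w + 1 + 1 < D" using w n_less_D by simp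
  let ?M = "(mem c)(2 * D + w := ?l + 1, off w + ?l + D := r)"
  have "lists_at (append_at w r L) ?M"
    using assms(1) by (intro lists_at_append[OF _ assms(8) w]) (simp add: machine_at_def)
  moreover have "input_at ?M" "marks_at (set vs) ?M" "stack_at vs ps ?M" "words_le S ?M"
    using assms(1,4) l w rD n_less_D by (simp_all add: machine_at_def base_def upd_simps)
  ultimately show ?thesis using assms(1-7) m w l rD n_less_D
    by (simp add: block_simps words_le_upd machine_at_def base_def)
qed

lemma block_root:
  assumes "machine_at L r ys 0 [] ps p a c" "pc c = 43" "r < n" "sublists L"
  shows "block S 7 c (\<lambda>c'. pc c' = 50 \<and> machine_at L r ys 1 [r] [] 0 0 c')"
proof -
  let ?M = "(mem c)(4 * D := r, 3 * D + r := 1)"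
  have rD: "r < D" using assms(3) n_less_D by simp
  have "stack_at [r] [] ?M" using rD by (simp add: stack_at_def)
  moreover have "marks_at {r} ?M"
    using assms(1) n_less_D by (intro marks_at_insert marks_at_upd) (simp_all add: machine_at_def)
  moreover have "input_at ?M" "lists_at L ?M" "words_le S ?M"
    using assms(1,4) rD n_less_D by (simp_all add: machine_at_def base_def upd_simps)
  ultimately show ?thesis using assms(1,2) rD n_less_D
    by (simp add: block_simps words_le_upd machine_at_def base_def One_nat_def [symmetric])
qed

lemma block_next_root:
  assumes "machine_at L r ys j vs ps p a c" "pc c = 107" "r < n"
  shows "block S 2 c (\<lambda>c'. pc c' = 11 \<and> machine_at L (r + 1) ys j vs ps p a c')"
  using assms n_less_D by (simp add: block_simps upd_simps machine_at_def base_def)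

lemma inp_le_D: "x \<in> set inp \<Longrightarrow> x \<le> D"
proof -
  assume x: "x \<in> set inp"
  have "off u \<le> D" if "u < n + 1" for u using off_le_D that by simp
  moreover have "v \<le> D" if "u \<in> set adj" "v \<in> set u" for u v
    using that adj_iff edge_bounds n_less_D by (fastforce simp: in_set_conv_nth[of u])
  ultimately show ?thesis using x k_bounds n_less_D by (auto simp: input_words_def off_def)
qed

lemma init_words: "word_bounded S (init_config inp)"
proof -
  have "inp ! a \<le> S" if "a < length inp" for a using inp_le_D[OF nth_mem[OF that]] by simp
  thus ?thesis by (simp add: word_bounded_def words_le_def init_config_def)
qed

lemma block_init:
  "block S 11 (init_config inp) (\<lambda>c'. pc c' = 11 \<and> machine_at (\<lambda>_. []) 0 [] 0 [] [] 0 0 c')"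
proof -
  let ?c = "init_config inp"
  have w: "words_le S (mem ?c)" using init_words by (simp add: word_bounded_def)
  have c: "pc ?c = 0" "reg ?c = (\<lambda>_. 0)" "out ?c = []" by (simp_all add: init_config_def)
  have m: "mem ?c 0 = n" "mem ?c 1 = k" "mem ?c (n + 1 + 1) = D"
  proof -
    have "n + 1 + 1 = n + 2" by (rule add.assoc [THEN trans]) (simp only: one_add_one)
    moreover have "mem ?c (n + 2) = D" using inp_off[of n] off_n n_less_D
      unfolding init_config_def D_def [symmetric] by simp
    ultimately show "mem ?c (n + 1 + 1) = D" by (simp only:)
  qed (use inp_0 inp_1 n_less_D in \<open>simp_all add: init_config_def D_def [symmetric]\<close>)
  have i: "input_at (mem ?c)" by (simp add: input_at_def init_config_def D_def)
  \<comment> \<open>Memory beyond the input is zero, which already represents empty lists and no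
    marks.\<close>
  have l: "lists_at (\<lambda>_. []) (mem ?c)" "marks_at {} (mem ?c)" "stack_at [] [] (mem ?c)"
    by (simp_all add: lists_at_def marks_at_def stack_at_def init_config_def D_def [symmetric])
  have "words_le S (\<lambda>_. 0)" by (simp add: words_le_def)
  thus ?thesis using w c m i l n_less_D k_bounds
    by (simp add: block_simps words_le_upd machine_at_def base_def)
qed

subsection \<open>The loop over the roots\<close>

text \<open>The lists midway through the insertion of \<open>r\<close>: complete below
  \<open>r\<close>, plus both directions of the edges from \<open>r\<close> to smaller vertices
  among its first \<open>q\<close> input entries.\<close>

definition grown :: "nat \<Rightarrow> nat \<Rightarrow> (nat \<Rightarrow> nat list) \<Rightarrow> bool" where
  "grown r q L \<longleftrightarrow> (\<forall>u. distinct (L u)) \<and> (\<forall>u x. x \<in> set (L u) \<longleftrightarrow> {u, x} \<in> E \<and>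
     (u < r \<and> x < r \<or> u = r \<and> x < r \<and> x \<in> set (take q (adj ! r)) \<or> x = r \<and> u < r \<and> u \<in> set (take q (adj ! r))))"

lemma grown_sublists: "grown r q L \<Longrightarrow> sublists L"
  by (simp add: grown_def sublists_def)

lemma grown_0: "grown 0 0 (\<lambda>_. [])"
  by (simp add: grown_def)

lemma grown_complete:
  assumes "grown r (length (adj ! r)) L" "r < n"
  shows "grown (r + 1) 0 L"
proof -
  have e: "u \<in> set (adj ! r) \<longleftrightarrow> {u, r} \<in> E" for u
    using adj_iff[OF assms(2)] by (simp add: insert_commute)
  have "{r, r} \<notin> E" using edge_bounds by blast
  thus ?thesis using assms(1) unfolding grown_def
    by (auto simp: e insert_commute less_Suc_eq simp flip: Suc_eq_plus1)
qed

text \<open>A neighbour above \<open>r\<close> is passed over for now; its edge enters when the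
  larger endpoint becomes the root.\<close>

lemma grown_skip:
  assumes "grown r q L" "r < n" "q < length (adj ! r)" "\<not> adj ! r ! q < r"
  shows "grown r (q + 1) L"
  using assms unfolding grown_def
  by (auto simp: take_Suc_conv_app_nth simp flip: Suc_eq_plus1)

lemma grown_append:
  assumes "grown r q L" "r < n" "q < length (adj ! r)" "adj ! r ! q < r"
  defines "w \<equiv> adj ! r ! q"
  shows "sublists (append_at r w L)" "grown r (q + 1) (append_at w r (append_at r w L))"
proof -
  have E: "{r, w} \<in> E" "{w, r} \<in> E"
    using adj_iff[OF assms(2)] nth_mem[OF assms(3)] by (auto simp: w_def insert_commute)
  have "w \<notin> set (take q (adj ! r))"
    using adj_distinct[OF assms(2)] assms(3)
    by (auto simp: w_def in_set_conv_nth nth_eq_iff_index_eq)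
  hence new: "w \<notin> set (L r)" "r \<notin> set (L w)"
    using assms(1,4) by (auto simp: grown_def w_def)
  show s: "sublists (append_at r w L)"
    using grown_sublists[OF assms(1)] E new by (auto simp: sublists_def append_at_def)
  have t: "set (take (q + 1) (adj ! r)) = insert w (set (take q (adj ! r)))"
    using assms(3) by (simp add: take_Suc_conv_app_nth w_def flip: Suc_eq_plus1)
  have m: "x \<in> set (L u) \<longleftrightarrow> {u, x} \<in> E \<and>
     (u < r \<and> x < r \<or> u = r \<and> x < r \<and> x \<in> set (take q (adj ! r)) \<or> x = r \<and> u < r \<and> u \<in> set (take q (adj ! r)))" for u x
    using assms(1) by (simp add: grown_def)
  have wr: "w < r" "w \<noteq> r" using assms(4) by (auto simp: w_def)
  have "distinct (append_at w r (append_at r w L) u)" for u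
    using assms(1) new wr by (auto simp: grown_def append_at_def)
  moreover have "x \<in> set (append_at w r (append_at r w L) u) \<longleftrightarrow>
      x \<in> set (L u) \<or> u = r \<and> x = w \<or> u = w \<and> x = r" for u x
    using wr by (auto simp: append_at_def)
  ultimately show "grown r (q + 1) (append_at w r (append_at r w L))"
    unfolding grown_def t using m E wr by auto
qed

text \<open>Inserting an edge takes 14 + 11 = 25 instructions, one part for each direction.\<close>

lemma grow_loop_reach:
  assumes "machine_at L r ys j vs ps p a c" "pc c = 17" "r < n" "q \<le> length (adj ! r)"
    "reg c 19 = off r + q" "reg c 20 = off (r + 1)" "grown r q L"
  shows "reach prog B S c (25 * (length (adj ! r) - q) + 1)
    (\<lambda>c'. pc c' = 43 \<and> (\<exists>L'. machine_at L' r ys j vs ps p a c' \<and> grown (r + 1) 0 L'))"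
  using assms
proof (induction "length (adj ! r) - q" arbitrary: q L c)
  case 0
  hence q: "q = length (adj ! r)" by simp
  hence "reg c 19 = reg c 20" using 0 off_Suc[of r] by (simp flip: Suc_eq_plus1)
  from block_reach[OF block_grow_end[OF 0(2,3) this] machine_at_base[OF 0(2)]]
  have r: "reach prog B S c 1 (\<lambda>c'. pc c' = 43 \<and> machine_at L r ys j vs ps p a c')" by simp
  have "grown (r + 1) 0 L" using grown_complete[of r L] 0(4,8) q by simp
  thus ?case by (intro reach_mono[OF r]) auto
next
  case (Suc d)
  let ?w = "adj ! r ! q"
  have q: "q < length (adj ! r)" and d: "d = length (adj ! r) - (q + 1)" using Suc.hyps(2) by simp_all
  let ?Q = "\<lambda>c'. pc c' = 43 \<and> (\<exists>L'. machine_at L' r ys j vs ps p a c' \<and> grown (r + 1) 0 L')"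
  have IH: "reach prog B S c' (25 * (length (adj ! r) - (q + 1)) + 1) ?Q"
    if "machine_at L' r ys j vs ps p a c'" "pc c' = 17" "reg c' 19 = off r + q + 1" "reg c' 20 = off (r + 1)"
      "grown r (q + 1) L'" for L' c'
    using q that Suc.prems(3) by (intro Suc.hyps(1)[OF d]) simp_all
  have "reach prog B S c (25 + (25 * (length (adj ! r) - (q + 1)) + 1)) ?Q"
  proof (cases "?w < r")
    case False
    show ?thesis
    proof (rule reach_trans)
      show "reach prog B S c 25 (\<lambda>c'. pc c' = 17 \<and> machine_at L r ys j vs ps p a c' \<and>
          reg c' 19 = off r + q + 1 \<and> reg c' 20 = off (r + 1))"
        by (rule block_reach[OF block_grow_skip[OF Suc.prems(1-3) q Suc.prems(5,6) False] machine_at_base[OF Suc.prems(1)]])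
          simp_all
    qed (use IH grown_skip[OF Suc.prems(7,3) q False] in blast)
  next
    case True
    note app = grown_append[OF Suc.prems(7,3) q True]
    have "reach prog B S c (14 + 11) (\<lambda>c'. pc c' = 17 \<and>
        machine_at (append_at ?w r (append_at r ?w L)) r ys j vs ps p a c' \<and>
        reg c' 19 = off r + q + 1 \<and> reg c' 20 = off (r + 1))"
    proof (rule reach_trans)
      show "reach prog B S c 14 (\<lambda>c'. pc c' = 32 \<and> machine_at (append_at r ?w L) r ys j vs ps p a c' \<and>
          reg c' 15 = ?w \<and> reg c' 19 = off r + q + 1 \<and> reg c' 20 = off (r + 1))"
        by (rule block_reach[OF block_grow_append_root[OF Suc.prems(1-3) q Suc.prems(5,6) True app(1)]
              machine_at_base[OF Suc.prems(1)]]) simp_all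
    next
      fix c' assume c': "pc c' = 32 \<and> machine_at (append_at r ?w L) r ys j vs ps p a c' \<and>
          reg c' 15 = ?w \<and> reg c' 19 = off r + q + 1 \<and> reg c' 20 = off (r + 1)"
      hence i: "machine_at (append_at r ?w L) r ys j vs ps p a c'" by simp
      show "reach prog B S c' 11 (\<lambda>c'. pc c' = 17 \<and>
          machine_at (append_at ?w r (append_at r ?w L)) r ys j vs ps p a c' \<and>
          reg c' 19 = off r + q + 1 \<and> reg c' 20 = off (r + 1))"
        by (rule block_reach[OF block_grow_append_neighbour[OF i _ True Suc.prems(3) _ _ _ grown_sublists[OF app(2)]] machine_at_base[OF i]])
          (use c' in simp_all)
    qed
    hence "reach prog B S c 25 (\<lambda>c'. pc c' = 17 \<and>
        machine_at (append_at ?w r (append_at r ?w L)) r ys j vs ps p a c' \<and>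
        reg c' 19 = off r + q + 1 \<and> reg c' 20 = off (r + 1))" by simp
    thus ?thesis by (rule reach_trans) (use IH app(2) in blast)
  qed
  moreover have "25 + (25 * (length (adj ! r) - (q + 1)) + 1) = 25 * (length (adj ! r) - q) + 1" using q by simp
  ultimately show ?case by simp
qed

text \<open>Subtrees inside \<open>{..<r}\<close> are those whose largest vertex is below
  \<open>r\<close>, hence the yield of the roots handled so far.\<close>

definition collected :: "nat \<Rightarrow> (nat \<times> nat) list list \<Rightarrow> bool" where
  "collected r ts \<longleftrightarrow> (\<forall>es\<in>set ts. length es = k - 1) \<and> distinct (map edge_set ts) \<and>
     edge_set ` set ts = {T \<in> k_subtrees E k. \<Union>T \<subseteq> {..<r}}"

lemma collected_0: "collected 0 []"
proof -
  have "\<not> \<Union>T \<subseteq> {}" if "T \<in> k_subtrees E k" for T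
  proof -
    have "card (\<Union>T) \<noteq> 0" using that k_bounds(2) by (simp add: k_subtrees_def)
    thus ?thesis by (metis card.empty subset_empty)
  qed
  hence "{T \<in> k_subtrees E k. \<Union>T \<subseteq> {..<0}} = {}" unfolding lessThan_0 by blast
  thus ?thesis unfolding collected_def by (simp only:) simp
qed

text \<open>Ensures that the subtraction of the trees already listed in \<open>outer_reach\<close>
  is not truncated.\<close>

lemma collected_length: "collected r ts \<Longrightarrow> length ts \<le> card (k_subtrees E k)"
proof -
  assume c: "collected r ts"
  have "length ts = card (edge_set ` set ts)"
    using c unfolding collected_def by (metis distinct_card length_map set_map)
  also have "\<dots> \<le> card (k_subtrees E k)"
    using c simple_graph_finite[OF simple] finite_k_subtrees
    by (intro card_mono) (auto simp: collected_def)
  finally show ?thesis .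
qed

text \<open>The lists describe the graph \<open>?E\<close> induced by \<open>{..<r + 1}\<close>. Its
  k-subtrees through \<open>r\<close> are those with largest vertex \<open>r\<close>, which makes
  them disjoint from the earlier ones.\<close>

lemma collected_Suc:
  assumes "collected r ts" "grown (r + 1) 0 L"
  shows "collected (r + 1) (ts @ enum L k [r] [] 0 0)"
proof -
  let ?E = "{e \<in> E. e \<subseteq> {..<r + 1}}"
  have "\<And>u. distinct (L u)" "\<And>u x. x \<in> set (L u) \<longleftrightarrow> {u, x} \<in> ?E"
    using assms(2) by (auto simp: grown_def)
  note e = enum_root[OF this k(1), of r]
  have "{T \<in> k_subtrees ?E k. r \<in> \<Union>T} = {T \<in> k_subtrees E k. \<Union>T \<subseteq> {..<r + 1} \<and> r \<in> \<Union>T}"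
    by (auto simp: k_subtrees_def)
  note e' = e(1)[unfolded this]
  have new: "{T \<in> k_subtrees E k. \<Union>T \<subseteq> {..<r + 1}} =
      {T \<in> k_subtrees E k. \<Union>T \<subseteq> {..<r}} \<union> {T \<in> k_subtrees E k. \<Union>T \<subseteq> {..<r + 1} \<and> r \<in> \<Union>T}"
  proof -
    have "X \<subseteq> {..<r + 1} \<longleftrightarrow> X \<subseteq> {..<r} \<or> X \<subseteq> {..<r + 1} \<and> r \<in> X" for X
      by (auto simp: less_Suc_eq simp flip: Suc_eq_plus1)
    thus ?thesis by blast
  qed
  have disj: "{T \<in> k_subtrees E k. \<Union>T \<subseteq> {..<r}} \<inter> {T \<in> k_subtrees E k. \<Union>T \<subseteq> {..<r + 1} \<and> r \<in> \<Union>T} = {}"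
    by auto
  show ?thesis
    unfolding collected_def set_append image_Un map_append distinct_append set_map ball_Un e' new
    using assms(1) e disj unfolding collected_def by simp
qed

text \<open>Each root starts at level 1 and so costs 100 k^2 even without output, which is the
  source of the term n k^2. Counting the trees still due globally lets the outputs of all roots add
  up to s.\<close>

lemma outer_reach:
  assumes "machine_at L r (encode_trees ts) 0 [] ps p a c" "pc c = 11" "r \<le> n" "grown r 0 L" "collected r ts"
  shows "reach prog B S c
    ((\<Sum>u\<in>{r..<n}. 25 * length (adj ! u) + 20) +
      100 * k\<^sup>2 * ((card (k_subtrees E k) - length ts) * (k + 1) + (n - r)) + 1)
    (\<lambda>c'. pc c' = 109 \<and> base c' \<and> (\<exists>ts'. out c' = encode_trees ts' \<and> collected n ts'))"
  using assms
proof (induction "n - r" arbitrary: r ts L ps p a c)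
  case 0
  hence r: "r = n" by simp
  have i: "machine_at L n (encode_trees ts) 0 [] ps p a c" using 0(2) r by simp
  from block_reach[OF block_halt[OF i 0(3)] machine_at_base[OF i]]
  have h: "reach prog B S c (0 + 100 * k\<^sup>2 * ((card (k_subtrees E k) - length ts) * (k + 1) + 0) + 1)
    (\<lambda>c'. pc c' = 109 \<and> machine_at L n (encode_trees ts) 0 [] ps p a c')" by simp
  have "collected n ts" using 0(6) r by simp
  hence "reach prog B S c (0 + 100 * k\<^sup>2 * ((card (k_subtrees E k) - length ts) * (k + 1) + 0) + 1)
    (\<lambda>c'. pc c' = 109 \<and> base c' \<and> (\<exists>ts'. out c' = encode_trees ts' \<and> collected n ts'))"
    by (intro reach_mono[OF h order_refl]) (auto simp: machine_at_def)
  thus ?case using r by simp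
next
  case (Suc d)
  hence r: "r < n" "d = n - (r + 1)" by simp_all
  let ?s = "card (k_subtrees E k)"
  let ?Q = "\<lambda>c'. pc c' = 109 \<and> base c' \<and> (\<exists>ts'. out c' = encode_trees ts' \<and> collected n ts')"
  let ?deg = "length (adj ! r)"
  let ?rest = "\<Sum>u\<in>{r + 1..<n}. 25 * length (adj ! u) + 20"
  let ?T = "\<lambda>l. ?rest + 100 * k\<^sup>2 * ((?s - (length ts + l)) * (k + 1) + (n - (r + 1))) + 1"
  have after_grow: "reach prog B S c' (10 + 100 * k\<^sup>2 * ((?s - length ts) * (k + 1) + (n - r)) + ?rest) ?Q"
    if c': "pc c' = 43 \<and> (\<exists>L'. machine_at L' r (encode_trees ts) 0 [] ps p a c' \<and> grown (r + 1) 0 L')" for c'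
  proof -
    obtain L' where L': "machine_at L' r (encode_trees ts) 0 [] ps p a c'" "grown (r + 1) 0 L'" using c' by blast
    note sub = grown_sublists[OF L'(2)]
    let ?es = "enum L' k [r] [] 0 0"
    have col: "collected (r + 1) (ts @ ?es)" using collected_Suc[OF Suc.prems(5) L'(2)] .
    have "reach prog B S c' (7 + (100 * k\<^sup>2 * (length ?es * (k + 1) + 1) + (2 + ?T (length ?es)))) ?Q"
    proof (rule reach_trans)
      show "reach prog B S c' 7 (\<lambda>c'. pc c' = 50 \<and> machine_at L' r (encode_trees ts) 1 [r] [] 0 0 c')"
        using block_reach[OF block_root[OF L'(1) _ r(1) sub] machine_at_base[OF L'(1)]] c' by simp
    next
      fix c1 assume c1: "pc c1 = 50 \<and> machine_at L' r (encode_trees ts) 1 [r] [] 0 0 c1"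
      have i: "machine_at L' r (encode_trees ts) (length [r]) [r] [] 0 0 c1" using c1 by (simp add: One_nat_def)
      have v: "valid [r] [] 0 0" using r(1) k_bounds by (simp add: valid_def)
      have e: "reach prog B S c1 (100 * k\<^sup>2 * (length ?es * (k + 1) + 1)) (\<lambda>c'. pc c' = 107 \<and>
         (\<exists>ps' p' a'. machine_at L' r (encode_trees (ts @ ?es)) 0 [] ps' p' a' c'))"
        using enumerate_reach[OF i _ v sub] c1 by (simp add: encode_trees_simps Suc_eq_plus1)
      show "reach prog B S c1 (100 * k\<^sup>2 * (length ?es * (k + 1) + 1) + (2 + ?T (length ?es))) ?Q"
      proof (rule reach_trans[OF e], elim conjE exE)
        fix c2 ps' p' a' assume c2: "pc c2 = 107" "machine_at L' r (encode_trees (ts @ ?es)) 0 [] ps' p' a' c2"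
        have "reach prog B S c2 2 (\<lambda>c'. pc c' = 11 \<and> machine_at L' (r + 1) (encode_trees (ts @ ?es)) 0 [] ps' p' a' c')"
          using block_reach[OF block_next_root[OF c2(2,1) r(1)] machine_at_base[OF c2(2)]] by simp
        thus "reach prog B S c2 (2 + ?T (length ?es)) ?Q"
        proof (rule reach_trans, elim conjE)
          fix c3 assume c3: "pc c3 = 11" "machine_at L' (r + 1) (encode_trees (ts @ ?es)) 0 [] ps' p' a' c3"
          have "r + 1 \<le> n" using r(1) by simp
          from Suc.hyps(1)[OF r(2) c3(2,1) this L'(2) col]
          show "reach prog B S c3 (?T (length ?es)) ?Q" by simp
        qed
      qed
    qed
    \<comment> \<open>The 10 consists of 7 for starting the root, 2 for moving to the next one and 1
      for the final halt.\<close>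
    moreover have "7 + (100 * k\<^sup>2 * (length ?es * (k + 1) + 1) + (2 + ?T (length ?es))) =
      10 + 100 * k\<^sup>2 * ((?s - length ts) * (k + 1) + (n - r)) + ?rest"
    proof -
      have distrib: "K * (l * q + 1) + K * (x * q + y) = K * ((l + x) * q + (y + 1))" for K l q x y :: nat
        by (simp add: algebra_simps)
      have "length ts + length ?es \<le> ?s" using collected_length[OF col] by simp
      then obtain x where x: "?s = length ts + length ?es + x" using le_Suc_ex by blast
      have sub: "length ts + length ?es + x - (length ts + length ?es) = x"
        "length ts + length ?es + x - length ts = length ?es + x" by linarith+
      have nr: "n - r = (n - (r + 1)) + 1" using r(1) by linarith
      show ?thesis
        using distrib[of "100 * k\<^sup>2" "length ?es" "k + 1" x "n - (r + 1)"]
        unfolding x sub nr by linarith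
    qed
    ultimately show ?thesis by (simp only:)
  qed
  have grow: "reach prog B S c (6 + (25 * (?deg - 0) + 1))
    (\<lambda>c'. pc c' = 43 \<and> (\<exists>L'. machine_at L' r (encode_trees ts) 0 [] ps p a c' \<and> grown (r + 1) 0 L'))"
  proof (rule reach_trans)
    show "reach prog B S c 6 (\<lambda>c'. pc c' = 17 \<and> machine_at L r (encode_trees ts) 0 [] ps p a c' \<and>
      reg c' 19 = off r \<and> reg c' 20 = off (r + 1))"
      using block_reach[OF block_grow_start[OF Suc.prems(1,2) r(1)] machine_at_base[OF Suc.prems(1)]] by simp
  next
    fix c1 assume "pc c1 = 17 \<and> machine_at L r (encode_trees ts) 0 [] ps p a c1 \<and>
      reg c1 19 = off r \<and> reg c1 20 = off (r + 1)"
    thus "reach prog B S c1 (25 * (?deg - 0) + 1)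
      (\<lambda>c'. pc c' = 43 \<and> (\<exists>L'. machine_at L' r (encode_trees ts) 0 [] ps p a c' \<and> grown (r + 1) 0 L'))"
      using Suc.prems(4) r(1) by (intro grow_loop_reach) auto
  qed
  have "(\<Sum>u\<in>{r..<n}. 25 * length (adj ! u) + 20) = (25 * ?deg + 20) + ?rest"
    using sum.atLeast_Suc_lessThan[OF r(1)] by (simp flip: Suc_eq_plus1)
  thus ?case by (intro reach_mono[OF reach_trans[OF grow after_grow]]) auto
qed

lemma length_concat_adj: "length (concat adj) = (\<Sum>u<n. length (adj ! u))"
  by (simp add: length_concat sum_list_sum_nth atLeast0LessThan)

text \<open>Handshake count: list entries are ordered pairs, and an edge arises from at most two of
  them.\<close>

lemma length_concat_adj_le: "length (concat adj) \<le> 2 * card E"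
proof -
  have fin: "finite E" using simple_graph_finite[OF simple] by simp
  have "length (concat adj) = (\<Sum>u<n. card (set (adj ! u)))"
    unfolding length_concat_adj using adj_distinct by (simp add: distinct_card)
  also have "\<dots> = card (SIGMA u:{..<n}. set (adj ! u))" by simp
  also have "\<dots> \<le> card (\<Union>e\<in>E. {(u, v). {u, v} = e})"
  proof (rule card_mono)
    have "(\<Union>e\<in>E. {(u, v). {u, v} = e}) \<subseteq> {..<n} \<times> {..<n}" using edge_bounds by auto
    thus "finite (\<Union>e\<in>E. {(u, v). {u, v} = e})" by (rule finite_subset) simp
    show "(SIGMA u:{..<n}. set (adj ! u)) \<subseteq> (\<Union>e\<in>E. {(u, v). {u, v} = e})"
      using adj_iff by auto
  qed
  also have "\<dots> \<le> (\<Sum>e\<in>E. card {(u, v). {u, v} = e})" by (rule card_UN_le[OF fin])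
  also have "\<dots> \<le> (\<Sum>e\<in>E. 2)"
  proof (rule sum_mono)
    fix e assume "e \<in> E"
    then obtain a b where "e = {a, b}" using simple unfolding simple_graph_def by blast
    hence "{(u, v). {u, v} = e} \<subseteq> {(a, b), (b, a)}" by (auto simp: doubleton_eq_iff)
    hence "card {(u, v). {u, v} = e} \<le> card {(a, b), (b, a)}" by (intro card_mono) auto
    also have "\<dots> \<le> 2" using card_insert_le_m1[of 2 "{(b, a)}" "(a, b)"] by simp
    finally show "card {(u, v). {u, v} = e} \<le> 2" .
  qed
  finally show ?thesis by simp
qed

lemma lists_k_subtrees:
  assumes "collected n ts"
  shows "lists_k_subtrees_once E k (encode_trees ts)"
proof -
  have "{T \<in> k_subtrees E k. \<Union>T \<subseteq> {..<n}} = k_subtrees E k"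
    using simple_graph_finite[OF simple] by (auto simp: k_subtrees_def)
  moreover have "encode_trees ts = concat (map (\<lambda>es. concat (map (\<lambda>(u, v). [u, v]) es)) ts)"
    by (simp add: encode_trees_def encode_edges_def [abs_def])
  ultimately show ?thesis using assms
    unfolding lists_k_subtrees_once_def collected_def by (intro exI[of _ ts]) simp
qed

lemma prog_run:
  "\<exists>t ys. ram_run prog inp B t S ys \<and> lists_k_subtrees_once E k ys \<and>
     t \<le> 12 + 25 * length (concat adj) + 20 * n + 100 * k\<^sup>2 * (card (k_subtrees E k) * (k + 1) + n)"
proof -
  let ?T = "(\<Sum>u\<in>{0..<n}. 25 * length (adj ! u) + 20) +
      100 * k\<^sup>2 * ((card (k_subtrees E k) - length ([] :: (nat \<times> nat) list list)) * (k + 1) + (n - 0)) + 1"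
  let ?Q = "\<lambda>c'. pc c' = 109 \<and> base c' \<and> (\<exists>ts'. out c' = encode_trees ts' \<and> collected n ts')"
  have "2 ^ 11 * S \<le> 2 ^ 32 * S" by simp
  hence le: "2 ^ 11 * S < B" using B unfolding D_def by linarith
  hence SB: "S < B" by simp
  have "consts_bounded S prog" using consts_bounded_prog k_bounds(4) by simp
  from straight_reach[OF block_init[unfolded block_def] init_words this le]
  have init: "reach prog B S (init_config inp) 11 (\<lambda>c'. pc c' = 11 \<and> machine_at (\<lambda>_. []) 0 [] 0 [] [] 0 0 c')" .
  have run: "reach prog B S (init_config inp) (11 + ?T) ?Q"
  proof (rule reach_trans[OF init], elim conjE)
    fix c assume c: "pc c = 11" "machine_at (\<lambda>_. []) 0 [] 0 [] [] 0 0 c"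
    hence i: "machine_at (\<lambda>_. []) 0 (encode_trees []) 0 [] [] 0 0 c" by (simp add: encode_trees_simps)
    show "reach prog B S c ?T ?Q" by (rule outer_reach[OF i c(1) _ grown_0 collected_0]) simp
  qed
  \<comment> \<open>The 12 is the initialisation of 11 steps plus the halting step.\<close>
  have Tle: "11 + ?T \<le> 12 + 25 * length (concat adj) + 20 * n + 100 * k\<^sup>2 * (card (k_subtrees E k) * (k + 1) + n)"
    unfolding length_concat_adj by (simp add: sum.distrib sum_distrib_left atLeast0LessThan)
  let ?R = "\<lambda>ys. \<exists>ts. ys = encode_trees ts \<and> collected n ts"
  have "reach prog B S (init_config inp) (11 + ?T) (\<lambda>c. halted prog c \<and> word_bounded S c \<and> ?R (out c))"
    by (rule reach_mono[OF run order_refl]) (auto simp: halted_def length_prog base_def word_bounded_def)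
  moreover have "length inp \<le> S" using k_bounds by (simp add: D_def [symmetric])
  ultimately obtain t ys where t: "t \<le> 11 + ?T" "ram_run prog inp B t S ys" "?R ys"
    by (rule reach_ram_run[OF _ SB])
  have "lists_k_subtrees_once E k ys" using t(3) lists_k_subtrees by blast
  thus ?thesis using t(1,2) Tle by (meson order_trans)
qed

end

subsection \<open>Resource bounds\<close>

text \<open>All bounds rest on n \<le> 2 m and m \<le> s k: the former turns vertices into edges,
  the latter edges into output. As m \<ge> 1, additive constants become multiples of m.\<close>

lemma resource_bounds:
  fixes n m k s l :: nat
  assumes "2 \<le> k" "1 \<le> n" "n \<le> Suc m" "m \<le> s * (k - 1)" "l \<le> 2 * m" "1 \<le> m"
  shows "12 + 25 * l + 20 * n + 100 * k\<^sup>2 * (s * (k + 1) + n) \<le> 1000 * (n * k\<^sup>2 + s * k ^ 3)"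
    and "n * k\<^sup>2 + s * k ^ 3 \<le> 1000 * (s * k ^ 3)"
    and "7 * (n + 3 + l) \<le> 1000 * (m * k)"
proof -
  have msk: "m \<le> s * k" using assms(4) by (meson diff_le_self le_trans mult_le_mono2)
  have n2: "n \<le> 2 * m" using assms by simp
  have k2: "1 \<le> k\<^sup>2" using assms(1) by simp
  have c: "s * k * k\<^sup>2 = s * k ^ 3" by (simp add: power2_eq_square power3_eq_cube)
  have sk: "s * k \<le> s * k ^ 3" using mult_le_mono2[OF k2, of "s * k"] unfolding c by simp
  have "n * k\<^sup>2 \<le> 2 * (s * k) * k\<^sup>2" using n2 msk by (intro mult_right_mono) auto
  also have "2 * (s * k) * k\<^sup>2 = 2 * (s * k * k\<^sup>2)" by (simp only: mult.assoc)
  finally have nk: "n * k\<^sup>2 \<le> 2 * (s * k ^ 3)" unfolding c .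
  thus "n * k\<^sup>2 + s * k ^ 3 \<le> 1000 * (s * k ^ 3)" by linarith
  have "s * (k + 1) \<le> 2 * (s * k)" using assms(1) by (simp add: algebra_simps)
  hence "k\<^sup>2 * (s * (k + 1)) \<le> k\<^sup>2 * (2 * (s * k))" by (rule mult_le_mono2)
  also have "\<dots> = 2 * (s * k ^ 3)" unfolding c [symmetric] by (simp add: mult_ac)
  finally have "k\<^sup>2 * (s * (k + 1)) \<le> 2 * (s * k ^ 3)" .
  moreover have "100 * k\<^sup>2 * (s * (k + 1) + n) = 100 * (k\<^sup>2 * (s * (k + 1))) + 100 * (n * k\<^sup>2)"
    by (simp add: algebra_simps)
  ultimately show "12 + 25 * l + 20 * n + 100 * k\<^sup>2 * (s * (k + 1) + n) \<le> 1000 * (n * k\<^sup>2 + s * k ^ 3)"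
    using msk n2 sk assms(5,6) unfolding distrib_left [of 1000] by linarith
  have "7 * (n + 3 + l) \<le> 49 * m" using n2 assms(5,6) by simp
  also have "\<dots> \<le> 1000 * (m * k)" using assms(1) by (intro mult_le_mono) simp_all
  finally show "7 * (n + 3 + l) \<le> 1000 * (m * k)" .
qed

text \<open>As n \<ge> 2, constants turn into powers of \<open>n\<close>: 2^32 for the blocks and
  2^5 for the factor 21 give n^39. The exponent is 1000 because a single \<open>C\<close> serves all
  bounds.\<close>

lemma word_size_bound:
  fixes n l :: nat
  assumes "2 \<le> n" "l \<le> n * n"
  shows "2 ^ 32 * (7 * (n + 3 + l)) < n ^ 1000"
proof -
  have n1: "1 \<le> n" using assms(1) by simp
  have "n \<le> n * n" "4 \<le> n * n" using assms(1) mult_le_mono[OF assms(1) assms(1)] by simp_all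
  hence "n + 3 + l \<le> n * n + n * n + n * n" using assms(2) by (intro add_mono) simp_all
  hence "7 * (n + 3 + l) \<le> 21 * (n * n)" by simp
  also have "\<dots> < 2 ^ 5 * (n * n)" using assms(1) by simp
  finally have "2 ^ 32 * (7 * (n + 3 + l)) < 2 ^ 32 * (2 ^ 5 * (n * n))" by simp
  also have "\<dots> = 2 ^ 37 * n ^ 2" by (simp add: power2_eq_square)
  also have "\<dots> \<le> n ^ 37 * n ^ 2" using assms(1) by (intro mult_right_mono power_mono) auto
  also have "\<dots> = n ^ 39" by (simp flip: power_add)
  also have "\<dots> \<le> n ^ 1000" using n1 by (intro power_increasing) auto
  finally show ?thesis .
qed

theorem theorem3p1:
  "\<exists>(P :: instr list) (C :: nat).
     \<forall>(V :: nat set) (E :: nat set set) (adj :: nat list list) (n :: nat) (m :: nat) (k :: nat) (s :: nat).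
       simple_graph V E \<longrightarrow> connected_graph V E \<longrightarrow> adjacency_lists V E adj \<longrightarrow>
       n = card V \<longrightarrow> m = card E \<longrightarrow> 2 \<le> k \<longrightarrow> k \<le> n \<longrightarrow> s = card (k_subtrees E k) \<longrightarrow>
       (\<exists>t S ys.
          ram_run P (input_words adj k) (n ^ C) t S ys \<and>
          lists_k_subtrees_once E k ys \<and>
          t \<le> C * (n * k ^ 2 + s * k ^ 3) \<and>
          n * k ^ 2 + s * k ^ 3 \<le> C * (s * k ^ 3) \<and>
          S \<le> C * (m * k))"
proof (rule exI[of _ prog], rule exI[of _ 1000], intro allI impI)
  fix V :: "nat set" and E :: "nat set set" and adj :: "nat list list" and n m k s :: nat
  assume simple: "simple_graph V E" and conn: "connected_graph V E" and adj: "adjacency_lists V E adj"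
    and n: "n = card V" and m: "m = card E" and k: "2 \<le> k" "k \<le> n" and s: "s = card (k_subtrees E k)"
  have V: "V = {..<length adj}" using adj by (simp add: adjacency_lists_def)
  have n_adj: "n = length adj" using n V by simp
  have deg: "length (adj ! u) \<le> n" if "u < n" for u
  proof -
    have "set (adj ! u) \<subseteq> V" "distinct (adj ! u)"
      using adj that n_adj simple_graph_finite[OF simple] by (auto simp: adjacency_lists_def)
    thus ?thesis using card_mono[of V "set (adj ! u)"] simple_graph_finite[OF simple] n
      by (simp add: distinct_card)
  qed
  have "length (concat adj) = (\<Sum>u<n. length (adj ! u))"
    unfolding n_adj by (simp add: length_concat sum_list_sum_nth atLeast0LessThan)
  also have "\<dots> \<le> (\<Sum>u<n. n)" using deg by (intro sum_mono) simp
  finally have l: "length (concat adj) \<le> n * n" by simp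
  have len: "length (input_words adj k) = n + 3 + length (concat adj)"
    by (simp add: input_words_def n_adj)
  interpret G: graph_input adj E k "n ^ 1000"
  proof
    show "2 ^ 32 * (7 * length (input_words adj k)) < n ^ 1000"
      unfolding len using word_size_bound[OF _ l] k by simp
  qed (use simple adj V k n_adj in simp_all)
  have nm: "n \<le> Suc m" using card_vertices_le[OF simple conn] n m by simp
  have ms: "m \<le> s * (k - 1)" using card_edges_le[OF simple conn k(1)] k(2) n m s by simp
  have lm: "length (concat adj) \<le> 2 * m" using G.length_concat_adj_le m by simp
  have nm1: "1 \<le> n" "1 \<le> m" using k nm by simp_all
  note bounds = resource_bounds[OF k(1) nm1(1) nm ms lm nm1(2)]
  obtain t ys where t: "ram_run prog (input_words adj k) (n ^ 1000) t (7 * G.D) ys"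
    "lists_k_subtrees_once E k ys"
    "t \<le> 12 + 25 * length (concat adj) + 20 * n + 100 * k\<^sup>2 * (s * (k + 1) + n)"
    using G.prog_run unfolding s n_adj by blast
  have "7 * G.D \<le> 1000 * (m * k)" using bounds(3) by (simp add: G.D_def len)
  moreover have "t \<le> 1000 * (n * k\<^sup>2 + s * k ^ 3)" using t(3) bounds(1) by (rule order_trans)
  ultimately show "\<exists>t S ys. ram_run prog (input_words adj k) (n ^ 1000) t S ys \<and>
      lists_k_subtrees_once E k ys \<and> t \<le> 1000 * (n * k ^ 2 + s * k ^ 3) \<and>
      n * k ^ 2 + s * k ^ 3 \<le> 1000 * (s * k ^ 3) \<and> S \<le> 1000 * (m * k)"
    using t(1,2) bounds(2) by blast
qed

end
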